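(* Work over $\mathbb{C}$ and let $Q\subset\mathbb{P}^3$ be a smooth quadric surface. For any two distinct hyperplanes $H,H'\subset\mathbb{P}^3$, one has $\mathcal{T}_Q(H;\mathbb{P}^3)\not\cong\mathcal{T}_Q(H';\mathbb{P}^3)$, where $\mathcal{T}_Q(H;\mathbb{P}^3)$ denotes the net logarithmic tangent sheaf on $Q$ associated to $H$.
   Context: Write $Q=\mathbb{V}(F)$, $H=\mathbb{V}(G)$ with $\deg F=2$, $\deg G=1$. Let $$\xi_{Q\cap H}=\begin{pmatrix}\nabla F\\ \nabla G\end{pmatrix}:\ \mathcal{O}_{\mathbb{P}^3}(1)^{\oplus 4}\to\mathcal{O}_{\mathbb{P}^3}(2)\oplus\mathcal{O}_{\mathbb{P}^3}(1)$$ be the Jacobian map, and set $\mathcal{T}_{Q\cap H,\mathbb{P}^3}:=\ker(\xi_{Q\cap H})$, $\mathcal{A}_{Q\cap H}:=\operatorname{Im}(\xi_{Q\cap H})$. The net logarithmic tangent sheaf is $$\mathcal{T}_Q(H;\mathbb{P}^3):=(\mathcal{T}_{Q\cap H,\mathbb{P}^3}\otimes\mathcal{O}_Q)\big/\mathcal{T}or_1^{\mathcal{O}_{\mathbb{P}^3}}(\mathcal{A}_{Q\cap H},\mathcal{O}_Q),$$ i.e. the image of $\mathcal{T}_{Q\cap H,\mathbb{P}^3}\otimes\mathcal{O}_Q\to\mathcal{O}_Q(1)^{\oplus 4}$; it is a torsion-free sheaf of rank $2$ on $Q$. *)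

theory Defs
  imports "HOL-Analysis.Analysis" "HOL-Library.Poly_Mapping" "HOL-Algebra.Module"
begin

section \<open>Polynomials in four variables\<close>

text \<open>Polynomials are formal: finitely supported functions from exponents to coefficients,
  with the convolution product of \<^theory>\<open>HOL-Library.Poly_Mapping\<close>.\<close>

type_synonym poly4 = "(4 \<Rightarrow>\<^sub>0 nat) \<Rightarrow>\<^sub>0 complex"

definition peval :: "poly4 \<Rightarrow> complex^4 \<Rightarrow> complex" where
  "peval f v = (\<Sum>m\<in>Poly_Mapping.keys f.
     Poly_Mapping.lookup f m * (\<Prod>i\<in>UNIV. (v $ i) ^ Poly_Mapping.lookup m i))"

definition partial :: "4 \<Rightarrow> poly4 \<Rightarrow> poly4" where
  "partial i f = (\<Sum>m\<in>Poly_Mapping.keys f.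
     Poly_Mapping.single (m - Poly_Mapping.single i 1)
       (of_nat (Poly_Mapping.lookup m i) * Poly_Mapping.lookup f m))"

definition homogeneous :: "nat \<Rightarrow> poly4 \<Rightarrow> bool" where
  "homogeneous d f \<longleftrightarrow>
     (\<forall>m\<in>Poly_Mapping.keys f. (\<Sum>i\<in>UNIV. Poly_Mapping.lookup m i) = d)"

lemma peval_superset:
  assumes "finite A" "Poly_Mapping.keys f \<subseteq> A"
  shows "peval f v = (\<Sum>m\<in>A.
     Poly_Mapping.lookup f m * (\<Prod>i\<in>UNIV. (v $ i) ^ Poly_Mapping.lookup m i))"
  unfolding peval_def
  by (rule sum.mono_neutral_left) (use assms in \<open>auto simp: in_keys_iff\<close>)

lemma peval_0 [simp]: "peval 0 v = 0"
  by (simp add: peval_def)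

lemma peval_add: "peval (f + g) v = peval f v + peval g v"
proof -
  let ?A = "Poly_Mapping.keys f \<union> Poly_Mapping.keys g"
  have "Poly_Mapping.keys (f + g) \<subseteq> ?A" by (rule keys_add)
  then show ?thesis
    by (simp add: peval_superset[of ?A] lookup_add distrib_right sum.distrib)
qed

lemma peval_sum: "peval (sum h A) v = (\<Sum>x\<in>A. peval (h x) v)"
  by (induction A rule: infinite_finite_induct) (auto simp: peval_add)

lemma peval_single:
  "peval (Poly_Mapping.single m c) v = c * (\<Prod>i\<in>UNIV. (v $ i) ^ Poly_Mapping.lookup m i)"
  by (simp add: peval_superset[of "{m}"])

lemma peval_1 [simp]: "peval 1 v = 1"
  by (simp flip: single_one add: peval_single)

lemma poly4_expand:
  "f = (\<Sum>m\<in>Poly_Mapping.keys f. Poly_Mapping.single m (Poly_Mapping.lookup f m))"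
  for f :: poly4
  by (rule poly_mapping_eqI)
     (auto simp: lookup_sum lookup_single when_def in_keys_iff)

lemma peval_mult: "peval (f * g) v = peval f v * peval g v"
proof -
  let ?F = "\<lambda>m. Poly_Mapping.single m (Poly_Mapping.lookup f m)"
  let ?G = "\<lambda>m. Poly_Mapping.single m (Poly_Mapping.lookup g m)"
  have "f * g = (\<Sum>m\<in>Poly_Mapping.keys f. \<Sum>n\<in>Poly_Mapping.keys g. ?F m * ?G n)"
    by (subst poly4_expand[of f], subst poly4_expand[of g]) (rule sum_product)
  then have "peval (f * g) v =
      (\<Sum>m\<in>Poly_Mapping.keys f. \<Sum>n\<in>Poly_Mapping.keys g. peval (?F m) v * peval (?G n) v)"
    by (simp add: peval_sum peval_single mult_single lookup_add power_add prod.distrib mult_ac)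
  also have "\<dots> = (\<Sum>m\<in>Poly_Mapping.keys f. peval (?F m) v) * (\<Sum>n\<in>Poly_Mapping.keys g. peval (?G n) v)"
    by (rule sum_product[symmetric])
  finally show ?thesis
    by (simp flip: peval_sum poly4_expand)
qed

lemma homogeneous_1 [simp]: "homogeneous 0 1"
  by (simp add: homogeneous_def flip: single_one)

lemma homogeneous_mult:
  assumes "homogeneous d f" "homogeneous e g"
  shows "homogeneous (d + e) (f * g)"
  unfolding homogeneous_def
proof
  fix m assume "m \<in> Poly_Mapping.keys (f * g)"
  then obtain a b where "m = a + b" "a \<in> Poly_Mapping.keys f" "b \<in> Poly_Mapping.keys g"
    using keys_mult[of f g] by blast
  then show "(\<Sum>i\<in>UNIV. Poly_Mapping.lookup m i) = d + e"
    using assms by (simp add: homogeneous_def lookup_add sum.distrib)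
qed


section \<open>Projective space with the Zariski topology\<close>

text \<open>Varieties over the complex numbers are described by their closed points. A point of
  projective space is a line through the origin of \<open>complex^4\<close>.\<close>

type_synonym point = "(complex^4) set"

definition proj3 :: "point set" where
  "proj3 = {vec.span {v} | v. v \<noteq> 0}"

definition vanishing :: "poly4 \<Rightarrow> point set" where
  "vanishing f = {p \<in> proj3. \<forall>v\<in>p. peval f v = 0}"

definition zariski_open :: "point set \<Rightarrow> bool" where
  "zariski_open U \<longleftrightarrow>
     (\<exists>S. (\<forall>f\<in>S. \<exists>d. homogeneous d f) \<and> U = proj3 - (\<Inter>f\<in>S. vanishing f))"

definition zariski :: "point topology" where
  "zariski = topology zariski_open"

definition cone :: "point set \<Rightarrow> (complex^4) set" where
  "cone U = {v. v \<noteq> 0 \<and> vec.span {v} \<in> U}"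

lemma peval_scale:
  assumes "homogeneous d f"
  shows "peval f (c *s v) = c ^ d * peval f v"
proof -
  have "(\<Prod>i\<in>UNIV. ((c *s v) $ i) ^ Poly_Mapping.lookup m i)
      = c ^ d * (\<Prod>i\<in>UNIV. (v $ i) ^ Poly_Mapping.lookup m i)"
    if "m \<in> Poly_Mapping.keys f" for m
    using assms that
    by (simp add: homogeneous_def power_mult_distrib prod.distrib flip: power_sum)
  then show ?thesis
    by (simp add: peval_def sum_distrib_left mult_ac)
qed

lemma span_in_vanishing_iff:
  assumes "homogeneous d f" "v \<noteq> 0"
  shows "vec.span {v} \<in> vanishing f \<longleftrightarrow> peval f v = 0"
proof -
  have "vec.span {v} \<in> proj3" using assms by (auto simp: proj3_def)
  moreover have "vec.span {v} = range (\<lambda>c. c *s v)" by (rule vec.span_singleton)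
  moreover have "v \<in> vec.span {v}" by (simp add: vec.span_base)
  ultimately show ?thesis
    using peval_scale[OF assms(1)] by (auto simp: vanishing_def)
qed

lemma vanishing_mult:
  assumes "homogeneous d f" "homogeneous e g"
  shows "vanishing (f * g) = vanishing f \<union> vanishing g"
proof -
  have "p \<in> vanishing (f * g) \<longleftrightarrow> p \<in> vanishing f \<or> p \<in> vanishing g" if p: "p \<in> proj3" for p
  proof -
    obtain v where v: "p = vec.span {v}" "v \<noteq> 0" using p by (auto simp: proj3_def)
    show ?thesis
      unfolding v(1) by (simp add: span_in_vanishing_iff[OF homogeneous_mult[OF assms] v(2)]
        span_in_vanishing_iff[OF assms(1) v(2)] span_in_vanishing_iff[OF assms(2) v(2)] peval_mult)
  qed
  then show ?thesis by (auto simp: vanishing_def)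
qed

lemma istopology_zariski_open: "istopology zariski_open"
  unfolding istopology_def
proof (intro conjI allI impI)
  fix U W assume "zariski_open U" "zariski_open W"
  then obtain S T where S: "\<forall>f\<in>S. \<exists>d. homogeneous d f" "U = proj3 - (\<Inter>f\<in>S. vanishing f)"
    and T: "\<forall>f\<in>T. \<exists>d. homogeneous d f" "W = proj3 - (\<Inter>f\<in>T. vanishing f)"
    unfolding zariski_open_def by blast
  let ?R = "(\<lambda>(f, g). f * g) ` (S \<times> T)"
  have "\<forall>f\<in>?R. \<exists>d. homogeneous d f"
    using S(1) T(1) homogeneous_mult by fastforce
  moreover have *: "vanishing (f * g) = vanishing f \<union> vanishing g" if "f \<in> S" "g \<in> T" for f g
    using that S(1) T(1) vanishing_mult by blast
  have "(\<Inter>h\<in>?R. vanishing h) = (\<Inter>f\<in>S. vanishing f) \<union> (\<Inter>g\<in>T. vanishing g)"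
    using * by fastforce
  then have "U \<inter> W = proj3 - (\<Inter>h\<in>?R. vanishing h)"
    using S(2) T(2) by blast
  ultimately show "zariski_open (U \<inter> W)"
    unfolding zariski_open_def by blast
next
  fix K assume "\<forall>U\<in>K. zariski_open U"
  then have "\<forall>U\<in>K. \<exists>S. (\<forall>f\<in>S. \<exists>d. homogeneous d f) \<and> U = proj3 - (\<Inter>f\<in>S. vanishing f)"
    unfolding zariski_open_def .
  then obtain S where S: "\<forall>U\<in>K. (\<forall>f\<in>S U. \<exists>d. homogeneous d f) \<and>
      U = proj3 - (\<Inter>f\<in>S U. vanishing f)"
    by (rule bchoice[THEN exE])
  have "\<Union>K = (\<Union>U\<in>K. proj3 - (\<Inter>f\<in>S U. vanishing f))"
    using S by auto
  also have "\<dots> = proj3 - (\<Inter>f\<in>(\<Union>U\<in>K. S U). vanishing f)"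
    by auto
  finally show "zariski_open (\<Union>K)"
    unfolding zariski_open_def using S by (intro exI[of _ "\<Union>U\<in>K. S U"]) blast
qed

lemma openin_zariski: "openin zariski = zariski_open"
  unfolding zariski_def by (rule topology_inverse'[OF istopology_zariski_open])

lemma topspace_zariski: "topspace zariski = proj3"
proof -
  have "vanishing 1 = {}"
    by (auto simp: vanishing_def proj3_def intro: vec.span_zero)
  then have "zariski_open proj3"
    unfolding zariski_open_def by (intro exI[of _ "{1}"]) (auto intro!: exI[of _ 0])
  moreover have "U \<subseteq> proj3" if "zariski_open U" for U
    using that by (auto simp: zariski_open_def)
  ultimately show ?thesis
    unfolding topspace_def openin_zariski by blast
qed


section \<open>Sheaves of modules\<close>

text \<open>A (pre)sheaf of modules over a given sheaf of rings. The two arguments of \<open>restr\<close> are the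
  larger and the smaller open set.\<close>

record ('p, 'r, 's) module_sheaf =
  sections :: "'p set \<Rightarrow> ('r, 's) module"
  restr :: "'p set \<Rightarrow> 'p set \<Rightarrow> 's \<Rightarrow> 's"

definition module_iso :: "('r, 'm) ring_scheme \<Rightarrow> ('r, 's) module \<Rightarrow> ('r, 't) module \<Rightarrow> ('s \<Rightarrow> 't) set"
  where "module_iso R M N = {h. bij_betw h (carrier M) (carrier N) \<and>
    (\<forall>x\<in>carrier M. \<forall>y\<in>carrier M. h (x \<oplus>\<^bsub>M\<^esub> y) = h x \<oplus>\<^bsub>N\<^esub> h y) \<and>
    (\<forall>a\<in>carrier R. \<forall>x\<in>carrier M. h (a \<odot>\<^bsub>M\<^esub> x) = a \<odot>\<^bsub>N\<^esub> h x)}"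

definition module_sheaf_iso ::
    "'p topology \<Rightarrow> ('p set \<Rightarrow> ('r, 'm) ring_scheme) \<Rightarrow>
     ('p, 'r, 's) module_sheaf \<Rightarrow> ('p, 'r, 't) module_sheaf \<Rightarrow> bool" where
  "module_sheaf_iso X R M N \<longleftrightarrow> (\<exists>\<phi>.
     (\<forall>U. openin X U \<longrightarrow> \<phi> U \<in> module_iso (R U) (sections M U) (sections N U)) \<and>
     (\<forall>U W. openin X U \<and> openin X W \<and> W \<subseteq> U \<longrightarrow>
        (\<forall>s\<in>carrier (sections M U). \<phi> W (restr M U W s) = restr N U W (\<phi> U s))))"


section \<open>Twisting sheaves\<close>

text \<open>For a closed subvariety \<open>X\<close> of projective space, a section of the sheaf \<open>O(d)\<close> of \<open>X\<close> over an
  open \<open>U\<close> is a function on the punctured affine cone over \<open>U\<close> that is locally a quotient of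
  homogeneous polynomials whose degrees differ by \<open>d\<close>. Functions are set to 0 outside the cone, so
  that equality of sections is equality of functions.\<close>

definition twist :: "point set \<Rightarrow> nat \<Rightarrow> point set \<Rightarrow> (complex^4 \<Rightarrow> complex) set" where
  "twist X d U = {s. (\<forall>v. v \<notin> cone U \<longrightarrow> s v = 0) \<and>
     (\<forall>p\<in>U. \<exists>W a b e. openin (subtopology zariski X) W \<and> p \<in> W \<and> W \<subseteq> U \<and>
        homogeneous (d + e) a \<and> homogeneous e b \<and>
        (\<forall>v\<in>cone W. peval b v \<noteq> 0 \<and> s v = peval a v / peval b v))}"

definition structure_sheaf :: "point set \<Rightarrow> point set \<Rightarrow> (complex^4 \<Rightarrow> complex) ring" where
  "structure_sheaf X U = \<lparr>carrier = twist X 0 U, mult = (\<lambda>a b v. a v * b v),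
     one = indicator (cone U), zero = (\<lambda>v. 0), add = (\<lambda>a b v. a v + b v)\<rparr>"

definition twist1_pow4 :: "point set \<Rightarrow> point set \<Rightarrow> (complex^4 \<Rightarrow> complex^4) set" where
  "twist1_pow4 X U = {s. \<forall>i. (\<lambda>v. s v $ i) \<in> twist X 1 U}"


section \<open>The net logarithmic tangent sheaf\<close>

definition jacobian_map ::
    "poly4 \<Rightarrow> poly4 \<Rightarrow> (complex^4 \<Rightarrow> complex^4) \<Rightarrow> (complex^4 \<Rightarrow> complex \<times> complex)" where
  "jacobian_map F G s = (\<lambda>v. (\<Sum>i\<in>UNIV. peval (partial i F) v * s v $ i,
                              \<Sum>i\<in>UNIV. peval (partial i G) v * s v $ i))"

definition log_tangent :: "poly4 \<Rightarrow> poly4 \<Rightarrow> point set \<Rightarrow> (complex^4 \<Rightarrow> complex^4) set" where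
  "log_tangent F G U = {t \<in> twist1_pow4 proj3 U. jacobian_map F G t = (\<lambda>v. (0, 0))}"

text \<open>With \<open>Q = vanishing F\<close>, the map from the tensor product of \<^const>\<open>log_tangent\<close> with the
  structure sheaf of \<open>Q\<close> to the fourth power of \<open>O(1)\<close> on \<open>Q\<close> sends \<open>t \<otimes> a\<close> to \<open>a\<close> times the
  restriction of \<open>t\<close>. A section lies in the image sheaf iff it is locally the image of a finite sum
  of such tensors.\<close>

definition net_log_sections :: "poly4 \<Rightarrow> poly4 \<Rightarrow> point set \<Rightarrow> (complex^4 \<Rightarrow> complex^4) set" where
  "net_log_sections F G U = {s \<in> twist1_pow4 (vanishing F) U.
     \<forall>p\<in>U. \<exists>W. openin zariski W \<and> p \<in> W \<and> W \<inter> vanishing F \<subseteq> U \<and>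
       (\<exists>(n::nat) a t.
          (\<forall>j<n. a j \<in> twist (vanishing F) 0 (W \<inter> vanishing F) \<and> t j \<in> log_tangent F G W) \<and>
          (\<forall>v\<in>cone (W \<inter> vanishing F). s v = (\<Sum>j<n. a j v *s t j v)))}"

text \<open>The fields \<open>mult\<close> and \<open>one\<close> of the module record are irrelevant.\<close>

definition net_log_tangent_sheaf ::
    "poly4 \<Rightarrow> poly4 \<Rightarrow> (point, complex^4 \<Rightarrow> complex, complex^4 \<Rightarrow> complex^4) module_sheaf" where
  "net_log_tangent_sheaf F G =
     \<lparr>sections = (\<lambda>U. \<lparr>carrier = net_log_sections F G U, mult = undefined, one = undefined,
        zero = (\<lambda>v. 0), add = (\<lambda>s t v. s v + t v), smult = (\<lambda>a s v. a v *s s v)\<rparr>),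
      restr = (\<lambda>U W s v. if v \<in> cone W then s v else 0)\<rparr>"

definition smooth_quadric :: "poly4 \<Rightarrow> bool" where
  "smooth_quadric F \<longleftrightarrow> homogeneous 2 F \<and>
     (\<forall>v. v \<noteq> 0 \<and> peval F v = 0 \<longrightarrow> (\<exists>i. peval (partial i F) v \<noteq> 0))"

definition hyperplane_form :: "poly4 \<Rightarrow> bool" where
  "hyperplane_form G \<longleftrightarrow> homogeneous 1 G \<and> G \<noteq> 0"

end

theory Submission
  imports Defs "HOL-Complex_Analysis.Complex_Analysis"
begin

text \<open>
  A smooth quadric \<open>Q\<close> is given by a nondegenerate symmetric form, and a hyperplane \<open>H\<close> with
  coefficient vector \<open>g\<close> is determined by its pole \<open>p\<close>, the vector whose product with every \<open>v\<close> is
  \<open>g \<cdot> v\<close>. The logarithmic vector fields of \<open>Q \<inter> H\<close> are orthogonal, at a point \<open>v\<close>, to both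
  \<open>v\<close> and \<open>p\<close>. Among them are the Koszul fields \<open>T\<^sub>u(v)\<close>, which correspond under the form to the
  covectors \<open>w \<mapsto> det (p, u, v, w)\<close>, up to sign. They depend linearly on \<open>u\<close>, and satisfy
  \<open>T\<^sub>p = 0\<close> and \<open>T\<^sub>v(v) = 0\<close>. These relations allow the pole to be read off from the sheaf.

  Let \<open>p\<close> and \<open>p'\<close> be the poles of two hyperplanes and let an isomorphism carry \<open>T\<^sub>u\<close> to a global
  section \<open>S\<^sub>u\<close> of the second sheaf. Global sections of \<open>O(1)\<close> on the quadric are linear forms
  (\<open>twist1_linear\<close>): on each line of the quadric a section is entire of linear growth, hence linear,
  and a function on the isotropic cone that is linear on isotropic planes is linear. So \<open>S\<^sub>u\<close> is
  linear in \<open>v\<close>, and \<open>\<tau>(u, v, w)\<close>, the product of \<open>S\<^sub>u(v)\<close> with \<open>w\<close>, is a trilinear form. Being a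
  section of the second sheaf means that \<open>\<tau>(u, v, v) = 0\<close> on the quadric and \<open>\<tau>(u, v, p') = 0\<close>; if
  \<open>p'\<close> lies on the quadric, also \<open>S\<^sub>u(p') = 0\<close> (\<open>net_log_sections_pole\<close>). The relations between
  the Koszul fields are preserved by the isomorphism, which gives \<open>\<tau>(v, v, w) = 0\<close> on the quadric
  and \<open>\<tau>(p, v, w) = 0\<close>.

  These conditions force \<open>\<tau>\<close> to be alternating and to be annihilated by both poles
  (\<open>trilinear_vanishes\<close>). If \<open>p\<close> and \<open>p'\<close> were independent, \<open>\<tau>\<close> would be an alternating trilinear
  form on a plane, hence 0; then every \<open>T\<^sub>u\<close> would be mapped to 0, which contradicts injectivity.
  So the poles, and with them the hyperplanes, coincide.
\<close>

section \<open>Linear and quadratic forms in four variables\<close>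

definition bdot :: "complex^4 \<Rightarrow> complex^4 \<Rightarrow> complex" where
  "bdot v w = (\<Sum>i\<in>UNIV. v $ i * w $ i)"

lemma bdot_simps:
  "bdot (u + v) w = bdot u w + bdot v w" "bdot w (u + v) = bdot w u + bdot w v"
  "bdot (c *s v) w = c * bdot v w" "bdot w (c *s v) = c * bdot w v"
  "bdot 0 w = 0" "bdot w 0 = 0"
  by (simp_all add: bdot_def algebra_simps sum.distrib sum_distrib_left)

lemma bdot_commute: "bdot v w = bdot w v"
  by (simp add: bdot_def mult.commute)

lemma bdot_axis [simp]: "bdot v (axis i 1) = v $ i"
  by (simp add: bdot_def axis_def if_distrib cong: if_cong)

lemma bdot_nondegenerate:
  assumes "\<And>w. bdot v w = 0" shows "v = 0"
  using assms[of "axis _ 1"] by (simp add: vec_eq_iff)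

lemma bdot_expand:
  assumes "\<And>u v. f (u + v) = f u + f v" "\<And>c v. f (c *s v) = c * f v"
  shows "f v = bdot (\<chi> j. f (axis j 1)) v"
proof -
  have f_sum: "f (sum x K) = (\<Sum>j\<in>K. f (x j))" if "finite K" for x and K :: "4 set"
    using that
  proof (induction K rule: finite_induct)
    case empty
    show ?case using assms(2)[of 0 0] by simp
  next
    case (insert j K)
    then show ?case by (simp add: assms(1))
  qed
  have "f v = f (\<Sum>j\<in>UNIV. v $ j *s axis j 1)" by (simp only: basis_expansion)
  also have "\<dots> = bdot (\<chi> j. f (axis j 1)) v"
    by (simp add: f_sum assms(2) bdot_def mult.commute)
  finally show ?thesis .
qed

lemma bdot_symmetric_matrix:
  assumes "transpose A = A"
  shows "bdot (A *v v) w = bdot (A *v w) v"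
proof -
  have A: "A $ i $ j = A $ j $ i" for i j
    using assms by (simp add: transpose_def vec_eq_iff)
  have "bdot (A *v v) w = (\<Sum>i\<in>UNIV. \<Sum>j\<in>UNIV. A $ i $ j * v $ j * w $ i)"
    by (simp add: bdot_def matrix_vector_mult_def sum_distrib_right)
  also have "\<dots> = (\<Sum>j\<in>UNIV. \<Sum>i\<in>UNIV. A $ i $ j * v $ j * w $ i)" by (rule sum.swap)
  also have "\<dots> = (\<Sum>j\<in>UNIV. \<Sum>i\<in>UNIV. A $ j $ i * w $ i * v $ j)"
  proof (intro sum.cong refl)
    fix i j
    show "A $ i $ j * v $ j * w $ i = A $ j $ i * w $ i * v $ j" using A[of i j] by simp
  qed
  also have "\<dots> = bdot (A *v w) v"
    by (simp add: bdot_def matrix_vector_mult_def sum_distrib_right)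
  finally show ?thesis .
qed

definition monomial_value :: "(4 \<Rightarrow>\<^sub>0 nat) \<Rightarrow> complex^4 \<Rightarrow> complex" where
  "monomial_value m v = (\<Prod>i\<in>UNIV. (v $ i) ^ Poly_Mapping.lookup m i)"

lemma monomial_value_0 [simp]: "monomial_value 0 v = 1"
  by (simp add: monomial_value_def)

lemma monomial_value_single [simp]: "monomial_value (Poly_Mapping.single a (Suc 0)) v = v $ a"
proof -
  have "(\<Prod>i\<in>UNIV. (v $ i) ^ Poly_Mapping.lookup (Poly_Mapping.single a (Suc 0)) i)
      = (\<Prod>i\<in>UNIV. if i = a then v $ i else 1)"
    by (rule prod.cong) (auto simp: lookup_single when_def)
  then show ?thesis by (simp add: monomial_value_def)
qed

lemma monomial_value_add: "monomial_value (m + n) v = monomial_value m v * monomial_value n v"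
  by (simp add: monomial_value_def lookup_add power_add prod.distrib)

lemma peval_monomials:
  "peval f v = (\<Sum>m\<in>Poly_Mapping.keys f. Poly_Mapping.lookup f m * monomial_value m v)"
  by (simp add: peval_def monomial_value_def)

lemma peval_partial:
  "peval (partial i f) v = (\<Sum>m\<in>Poly_Mapping.keys f. of_nat (Poly_Mapping.lookup m i) * Poly_Mapping.lookup f m *
      monomial_value (m - Poly_Mapping.single i 1) v)"
  by (simp add: partial_def peval_sum peval_single monomial_value_def)

lemma monomial_split:
  fixes m :: "4 \<Rightarrow>\<^sub>0 nat"
  assumes "(\<Sum>i\<in>UNIV. Poly_Mapping.lookup m i) = Suc d"
  obtains a n where "m = Poly_Mapping.single a (Suc 0) + n" "(\<Sum>i\<in>UNIV. Poly_Mapping.lookup n i) = d"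
proof -
  obtain a where a: "Poly_Mapping.lookup m a \<noteq> 0"
    using assms by (cases "\<forall>a. Poly_Mapping.lookup m a = 0") auto
  define n where "n = m - Poly_Mapping.single a (Suc 0)"
  have m: "m = Poly_Mapping.single a (Suc 0) + n"
    using a by (intro poly_mapping_eqI) (auto simp: n_def lookup_add lookup_minus lookup_single when_def)
  have "Suc d = (\<Sum>i\<in>UNIV. (if i = a then Suc 0 else 0) + Poly_Mapping.lookup n i)"
    unfolding assms[symmetric] by (subst m) (simp add: lookup_add lookup_single when_def eq_commute)
  then have "(\<Sum>i\<in>UNIV. Poly_Mapping.lookup n i) = d" by (simp add: sum.distrib)
  with m that show ?thesis by blast
qed

lemma monomial_degree_1:
  fixes m :: "4 \<Rightarrow>\<^sub>0 nat"
  assumes "(\<Sum>i\<in>UNIV. Poly_Mapping.lookup m i) = 1"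
  obtains a where "m = Poly_Mapping.single a (Suc 0)"
proof -
  obtain a n where m: "m = Poly_Mapping.single a (Suc 0) + n" and n: "(\<Sum>i\<in>UNIV. Poly_Mapping.lookup n i) = 0"
    by (rule monomial_split[of m 0]) (use assms in simp_all)
  from n have "n = 0" by (intro poly_mapping_eqI) simp
  then show ?thesis using m that by simp
qed

lemma monomial_degree_2:
  fixes m :: "4 \<Rightarrow>\<^sub>0 nat"
  assumes "(\<Sum>i\<in>UNIV. Poly_Mapping.lookup m i) = 2"
  obtains a b where "m = Poly_Mapping.single a (Suc 0) + Poly_Mapping.single b (Suc 0)"
proof -
  obtain a n where m: "m = Poly_Mapping.single a (Suc 0) + n" and n: "(\<Sum>i\<in>UNIV. Poly_Mapping.lookup n i) = 1"
    by (rule monomial_split[of m 1]) (use assms in simp_all)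
  obtain b where "n = Poly_Mapping.single b (Suc 0)" using n by (rule monomial_degree_1)
  then show ?thesis using m that by simp
qed

text \<open>Both identities are linear in the coefficients, so it is enough to find the matrix of a single
  monomial \<open>x\<^sub>a x\<^sub>b\<close>. The polynomial and its formal partial derivatives are treated together
  because the gradient, and not only the value, has to come from the same symmetric matrix.\<close>

lemma quadratic_matrix_of_terms:
  fixes c :: "(4 \<Rightarrow>\<^sub>0 nat) \<Rightarrow> complex"
  assumes "finite K" "\<And>m. m \<in> K \<Longrightarrow> (\<Sum>i\<in>UNIV. Poly_Mapping.lookup m i) = 2"
  shows "\<exists>A. transpose A = A \<and> (\<forall>v. (\<Sum>m\<in>K. c m * monomial_value m v) = bdot (A *v v) v) \<and>
    (\<forall>i v. (\<Sum>m\<in>K. of_nat (Poly_Mapping.lookup m i) * c m * monomial_value (m - Poly_Mapping.single i 1) v)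
       = 2 * (A *v v) $ i)"
  using assms
proof (induction K rule: finite_induct)
  case empty
  show ?case by (intro exI[of _ 0]) (simp add: transpose_def vec_eq_iff bdot_simps)
next
  case (insert m K)
  from insert.IH[OF insert.prems] obtain A where A: "transpose A = A"
    "\<And>v. (\<Sum>m\<in>K. c m * monomial_value m v) = bdot (A *v v) v"
    "\<And>i v. (\<Sum>m\<in>K. of_nat (Poly_Mapping.lookup m i) * c m * monomial_value (m - Poly_Mapping.single i 1) v)
       = 2 * (A *v v) $ i" by blast
  obtain a b where m: "m = Poly_Mapping.single a (Suc 0) + Poly_Mapping.single b (Suc 0)"
    by (rule monomial_degree_2[of m]) (use insert.prems in simp_all)
  define E :: "complex^4^4" where
    "E = (\<chi> i j. c m / 2 * (of_bool (i = a) * of_bool (j = b) + of_bool (i = b) * of_bool (j = a)))"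
  have pick: "(\<Sum>j\<in>UNIV. of_bool (j = k) * x j) = x k" for k :: 4 and x :: "4 \<Rightarrow> complex"
    by (simp add: sum_of_bool_mult_eq)
  have E_sym: "transpose E = E" by (auto simp: E_def transpose_def vec_eq_iff)
  have Ev: "(E *v v) $ i = c m / 2 * (of_bool (i = a) * v $ b + of_bool (i = b) * v $ a)" for v i
  proof -
    have "(E *v v) $ i = (\<Sum>j\<in>UNIV. c m / 2 * of_bool (i = a) * (of_bool (j = b) * v $ j)
        + c m / 2 * of_bool (i = b) * (of_bool (j = a) * v $ j))"
      by (simp add: E_def matrix_vector_mult_def algebra_simps)
    then show ?thesis
      by (simp only: sum.distrib pick flip: sum_distrib_left) (simp add: algebra_simps)
  qed
  have val: "c m * monomial_value m v = bdot (E *v v) v" for v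
  proof -
    have "bdot (E *v v) v = (\<Sum>i\<in>UNIV. c m / 2 * v $ b * (of_bool (i = a) * v $ i)
        + c m / 2 * v $ a * (of_bool (i = b) * v $ i))"
      by (simp add: bdot_def Ev algebra_simps)
    also have "\<dots> = c m / 2 * v $ b * v $ a + c m / 2 * v $ a * v $ b"
      by (simp only: sum.distrib pick flip: sum_distrib_left)
    finally show ?thesis by (simp add: m monomial_value_add)
  qed
  have par: "of_nat (Poly_Mapping.lookup m i) * c m * monomial_value (m - Poly_Mapping.single i 1) v
      = 2 * (E *v v) $ i" for i v
  proof -
    have m_a: "m - Poly_Mapping.single a 1 = Poly_Mapping.single b (Suc 0)" by (simp add: m)
    have m_b: "m - Poly_Mapping.single b 1 = Poly_Mapping.single a (Suc 0)" by (simp add: m)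
    have l: "Poly_Mapping.lookup m i = of_bool (i = a) + of_bool (i = b)"
      by (auto simp: m lookup_add lookup_single when_def)
    consider "i = a" "i = b" | "i = a" "i \<noteq> b" | "i = b" "i \<noteq> a" | "i \<noteq> a" "i \<noteq> b" by blast
    then show ?thesis
    proof cases
      case 1 then show ?thesis using m_b unfolding l by (simp add: Ev)
    next
      case 2 then show ?thesis using m_a unfolding l by (simp add: Ev)
    next
      case 3 then show ?thesis using m_b unfolding l by (simp add: Ev)
    next
      case 4 then show ?thesis unfolding l by (simp add: Ev)
    qed
  qed
  show ?case
  proof (intro exI[of _ "E + A"] conjI allI)
    show "transpose (E + A) = E + A" using A(1) E_sym by (simp add: transpose_def vec_eq_iff)
    fix v
    show "(\<Sum>m\<in>insert m K. c m * monomial_value m v) = bdot ((E + A) *v v) v"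
      using insert.hyps val[of v] A(2)[of v] by (simp add: matrix_vector_mult_add_rdistrib bdot_simps)
    fix i
    show "(\<Sum>m\<in>insert m K. of_nat (Poly_Mapping.lookup m i) * c m * monomial_value (m - Poly_Mapping.single i 1) v)
       = 2 * ((E + A) *v v) $ i"
      using insert.hyps par[of i v] A(3)[of i v]
      by (simp add: matrix_vector_mult_add_rdistrib distrib_left)
  qed
qed

text \<open>A vector in the kernel of the matrix would be a zero of \<open>F\<close> at which all partial derivatives
  vanish, so smoothness of the quadric is invertibility of the matrix.\<close>

lemma smooth_quadric_gram_matrix:
  assumes "smooth_quadric F"
  obtains A where "transpose A = A" "\<And>v. peval F v = bdot (A *v v) v"
    "\<And>i v. peval (partial i F) v = 2 * (A *v v) $ i" "invertible A"
proof -
  have "\<forall>m\<in>Poly_Mapping.keys F. (\<Sum>i\<in>UNIV. Poly_Mapping.lookup m i) = 2"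
    using assms by (simp add: smooth_quadric_def homogeneous_def)
  then have "\<exists>A. transpose A = A \<and> (\<forall>v. peval F v = bdot (A *v v) v) \<and>
      (\<forall>i v. peval (partial i F) v = 2 * (A *v v) $ i)"
    unfolding peval_partial unfolding peval_monomials by (intro quadratic_matrix_of_terms) auto
  then obtain A where A: "transpose A = A" "\<And>v. peval F v = bdot (A *v v) v"
    "\<And>i v. peval (partial i F) v = 2 * (A *v v) $ i" by blast
  have "v = 0" if "A *v v = 0" for v
  proof (rule ccontr)
    assume "v \<noteq> 0"
    moreover have "peval F v = 0" using A(2) that by (simp add: bdot_simps)
    ultimately obtain i where "peval (partial i F) v \<noteq> 0"
      using assms by (auto simp: smooth_quadric_def)
    then show False using A(3) that by simp
  qed
  then have "invertible A"
    by (simp add: invertible_left_inverse matrix_left_invertible_ker)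
  with A that show ?thesis by blast
qed

lemma hyperplane_vector:
  assumes "hyperplane_form G"
  obtains g where "g \<noteq> 0" "\<And>v. peval G v = bdot g v" "\<And>i v. peval (partial i G) v = g $ i"
proof -
  let ?e = "\<lambda>i::4. Poly_Mapping.single i (Suc 0)"
  have keys: "Poly_Mapping.keys G \<subseteq> range ?e"
  proof
    fix m assume "m \<in> Poly_Mapping.keys G"
    then have "(\<Sum>i\<in>UNIV. Poly_Mapping.lookup m i) = 1"
      using assms by (simp add: hyperplane_form_def homogeneous_def)
    then show "m \<in> range ?e" using monomial_degree_1 by blast
  qed
  have inj: "inj ?e"
  proof (rule injI)
    fix i j assume "?e i = ?e j"
    then have "Poly_Mapping.lookup (?e i) i = Poly_Mapping.lookup (?e j) i" by (rule arg_cong)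
    then show "i = j" by (simp add: lookup_single when_def split: if_splits)
  qed
  define g :: "complex^4" where "g = (\<chi> i. Poly_Mapping.lookup G (?e i))"
  have "g \<noteq> 0"
  proof
    assume "g = 0"
    then have "Poly_Mapping.lookup G (?e i) = 0" for i by (simp add: g_def vec_eq_iff)
    then have "Poly_Mapping.keys G = {}" using keys in_keys_iff[of _ G] by blast
    then show False using assms by (simp add: hyperplane_form_def)
  qed
  moreover have "peval G v = bdot g v" for v
  proof -
    have "peval G v = (\<Sum>m\<in>range ?e. Poly_Mapping.lookup G m * monomial_value m v)"
      unfolding monomial_value_def by (rule peval_superset) (use keys in simp_all)
    then show ?thesis using inj by (simp add: sum.reindex bdot_def g_def)
  qed
  moreover have "peval (partial i G) v = g $ i" for i v
  proof -
    have "peval (partial i G) v = (\<Sum>m\<in>range ?e. of_nat (Poly_Mapping.lookup m i) * Poly_Mapping.lookup G m *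
        monomial_value (m - ?e i) v)"
      unfolding peval_partial using keys
      by (intro sum.mono_neutral_cong_left) (auto simp: in_keys_iff)
    also have "\<dots> = (\<Sum>j\<in>UNIV. of_nat (Poly_Mapping.lookup (?e j) i) * Poly_Mapping.lookup G (?e j) *
        monomial_value (?e j - ?e i) v)"
      using inj by (simp add: sum.reindex)
    also have "\<dots> = (\<Sum>j\<in>UNIV. if j = i then Poly_Mapping.lookup G (?e i) else 0)"
      by (rule sum.cong) (auto simp: lookup_single when_def)
    finally show ?thesis by (simp add: g_def)
  qed
  ultimately show ?thesis by (rule that)
qed

lemma linear_form_poly:
  obtains f where "homogeneous 1 f" "\<And>v. peval f v = bdot c v"
proof -
  define f :: poly4 where "f = (\<Sum>i\<in>UNIV. Poly_Mapping.single (Poly_Mapping.single i (Suc 0)) (c $ i))"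
  have "Poly_Mapping.keys f \<subseteq> range (\<lambda>i. Poly_Mapping.single i (Suc 0))"
    unfolding f_def by (rule order_trans[OF keys_sum]) auto
  then have "homogeneous 1 f"
    by (auto simp: homogeneous_def lookup_single when_def)
  moreover have "peval f v = bdot c v" for v
    by (simp add: f_def peval_sum peval_single bdot_def flip: monomial_value_def)
  ultimately show ?thesis by (rule that)
qed

lemma homogeneous_add:
  assumes "homogeneous d f" "homogeneous d g"
  shows "homogeneous d (f + g)"
  using assms keys_add[of f g] by (auto simp: homogeneous_def)

lemma constant_poly:
  obtains f where "homogeneous 0 f" "\<And>v. peval f v = c"
  by (rule that[of "Poly_Mapping.single 0 c"]) (auto simp: homogeneous_def peval_single)


section \<open>Isotropic vectors of a nondegenerate form\<close>

definition bilinear_form :: "(complex^4 \<Rightarrow> complex^4 \<Rightarrow> complex) \<Rightarrow> bool" where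
  "bilinear_form \<beta> \<longleftrightarrow>
     (\<forall>u v w. \<beta> (u + v) w = \<beta> u w + \<beta> v w) \<and> (\<forall>u v w. \<beta> w (u + v) = \<beta> w u + \<beta> w v) \<and>
     (\<forall>c v w. \<beta> (c *s v) w = c * \<beta> v w) \<and> (\<forall>c v w. \<beta> w (c *s v) = c * \<beta> w v)"

lemma bilinear_formD:
  assumes "bilinear_form \<beta>"
  shows "\<beta> (u + v) w = \<beta> u w + \<beta> v w" "\<beta> w (u + v) = \<beta> w u + \<beta> w v"
    "\<beta> (c *s v) w = c * \<beta> v w" "\<beta> w (c *s v) = c * \<beta> w v"
  using assms by (simp_all add: bilinear_form_def)

text \<open>Independence of four vectors says that the matrix with these columns has a left inverse; for
  square matrices this is also a right inverse.\<close>

lemma four_independent_span: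
  fixes e\<^sub>1 e\<^sub>2 e\<^sub>3 e\<^sub>4 v :: "complex^4"
  assumes "\<And>a b c d. a *s e\<^sub>1 + b *s e\<^sub>2 + c *s e\<^sub>3 + d *s e\<^sub>4 = 0 \<Longrightarrow> a = 0 \<and> b = 0 \<and> c = 0 \<and> d = 0"
  obtains a b c d where "v = a *s e\<^sub>1 + b *s e\<^sub>2 + c *s e\<^sub>3 + d *s e\<^sub>4"
proof -
  define P :: "complex^4^4" where "P = (\<chi> i j. if j = 1 then e\<^sub>1 $ i else if j = 2 then e\<^sub>2 $ i else if j = 3 then e\<^sub>3 $ i else e\<^sub>4 $ i)"
  have P: "P *v w = (w $ 1) *s e\<^sub>1 + (w $ 2) *s e\<^sub>2 + (w $ 3) *s e\<^sub>3 + (w $ 4) *s e\<^sub>4" for w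
    by (simp add: P_def matrix_vector_mult_def vec_eq_iff sum_4 algebra_simps)
  have "w = 0" if "P *v w = 0" for w
  proof -
    have "(w $ 1) *s e\<^sub>1 + (w $ 2) *s e\<^sub>2 + (w $ 3) *s e\<^sub>3 + (w $ 4) *s e\<^sub>4 = 0"
      using that P by simp
    from assms[OF this] show ?thesis by (simp add: vec_eq_iff forall_4)
  qed
  then have "\<exists>P'. P' ** P = mat 1" by (simp add: matrix_left_invertible_ker)
  then have "\<exists>P'. P ** P' = mat 1" by (simp add: matrix_left_right_inverse)
  then obtain P' where "P ** P' = mat 1" by blast
  then have "v = P *v (P' *v v)" by (simp add: matrix_vector_mul_assoc)
  then show ?thesis unfolding P by (rule that)
qed

lemma vec_span_small:
  fixes xs :: "(complex^4) list"
  assumes "length xs < 4"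
  obtains x where "x \<notin> vec.span (set xs)"
proof -
  have "vec.dim (vec.span (set xs)) \<le> card (set xs)"
    unfolding vec.dim_span by (rule vec.dim_le_card') simp
  also have "\<dots> \<le> length xs" by (rule card_length)
  also note assms
  finally have "vec.dim (vec.span (set xs)) < 4" .
  moreover have "vec.dim (UNIV :: (complex^4) set) = 4"
    by (simp add: card_cart_basis)
  ultimately have "vec.span (set xs) \<noteq> UNIV" by (metis less_irrefl)
  then show ?thesis using that by blast
qed

locale nondegenerate_form =
  fixes B :: "complex^4 \<Rightarrow> complex^4 \<Rightarrow> complex"
  assumes add_left: "B (u + v) w = B u w + B v w"
    and scale_left: "B (c *s v) w = c * B v w"
    and sym: "B v w = B w v"
    and nondegenerate: "(\<And>w. B v w = 0) \<Longrightarrow> v = 0"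
begin

lemma add_right: "B w (u + v) = B w u + B w v"
  using add_left sym by metis

lemma scale_right: "B w (c *s v) = c * B w v"
  using scale_left sym by metis

lemma zero_left [simp]: "B 0 v = 0"
  using scale_left[of 0 0 v] by simp

lemma zero_right [simp]: "B v 0 = 0"
  using zero_left sym by metis

lemma diff_left: "B (u - v) w = B u w - B v w"
  using add_left[of "u - v" v w] by simp

lemma diff_right: "B w (u - v) = B w u - B w v"
  using diff_left sym by metis

lemma minus_left: "B (- v) w = - B v w"
  using diff_left[of 0 v w] by simp

lemma minus_right: "B w (- v) = - B w v"
  using minus_left sym by metis

lemmas B_bilinear = minus_left minus_right add_left add_right scale_left scale_right diff_left diff_right

text \<open>A quadratic equation in one unknown is solvable over the complex numbers.\<close>

lemma isotropic_in_plane: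
  obtains a b where "a \<noteq> 0 \<or> b \<noteq> 0" "B (a *s u + b *s w) (a *s u + b *s w) = 0"
proof (cases "B w w = 0")
  case True
  then show ?thesis using that[of 0 1] by simp
next
  case False
  define r where "r = csqrt ((B u w)^2 - B w w * B u u)"
  have r: "r^2 = (B u w)^2 - B w w * B u u" by (simp add: r_def)
  define z where "z = (r - B u w) / B w w"
  have z: "z * B w w = r - B u w" using False by (simp add: z_def)
  have "B w w * (B u u + 2 * z * B u w + z^2 * B w w) = B w w * B u u + 2 * (z * B w w) * B u w + (z * B w w)^2"
    by (simp add: algebra_simps power2_eq_square)
  also have "\<dots> = 0" unfolding z using r by (simp add: algebra_simps power2_eq_square)
  finally have "B u u + 2 * z * B u w + z^2 * B w w = 0" using False by simp
  then show ?thesis using that[of 1 z] sym[of w u]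
    by (simp add: B_bilinear algebra_simps power2_eq_square)
qed

text \<open>In such coordinates the form is \<open>2 (x\<^sub>1 x\<^sub>4 - x\<^sub>2 x\<^sub>3)\<close>, and the quadric is the image of the
  Segre embedding of the product of two projective lines. The planes spanned by \<open>e\<^sub>1, e\<^sub>2\<close>, by
  \<open>e\<^sub>1, e\<^sub>3\<close>, by \<open>e\<^sub>2, e\<^sub>4\<close> and by \<open>e\<^sub>3, e\<^sub>4\<close> are isotropic: they are lines on the quadric.\<close>

definition hyperbolic :: "complex^4 \<Rightarrow> complex^4 \<Rightarrow> complex^4 \<Rightarrow> complex^4 \<Rightarrow> bool" where
  "hyperbolic e\<^sub>1 e\<^sub>2 e\<^sub>3 e\<^sub>4 \<longleftrightarrow> B e\<^sub>1 e\<^sub>1 = 0 \<and> B e\<^sub>2 e\<^sub>2 = 0 \<and> B e\<^sub>3 e\<^sub>3 = 0 \<and> B e\<^sub>4 e\<^sub>4 = 0 \<and>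
    B e\<^sub>1 e\<^sub>2 = 0 \<and> B e\<^sub>1 e\<^sub>3 = 0 \<and> B e\<^sub>2 e\<^sub>4 = 0 \<and> B e\<^sub>3 e\<^sub>4 = 0 \<and> B e\<^sub>1 e\<^sub>4 = 1 \<and> B e\<^sub>2 e\<^sub>3 = -1"

lemma hyperbolic_table:
  assumes "hyperbolic e\<^sub>1 e\<^sub>2 e\<^sub>3 e\<^sub>4"
  shows "B e\<^sub>1 e\<^sub>1 = 0" "B e\<^sub>2 e\<^sub>2 = 0" "B e\<^sub>3 e\<^sub>3 = 0" "B e\<^sub>4 e\<^sub>4 = 0"
    "B e\<^sub>1 e\<^sub>2 = 0" "B e\<^sub>1 e\<^sub>3 = 0" "B e\<^sub>2 e\<^sub>4 = 0" "B e\<^sub>3 e\<^sub>4 = 0" "B e\<^sub>1 e\<^sub>4 = 1" "B e\<^sub>2 e\<^sub>3 = -1"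
    "B e\<^sub>2 e\<^sub>1 = 0" "B e\<^sub>3 e\<^sub>1 = 0" "B e\<^sub>4 e\<^sub>2 = 0" "B e\<^sub>4 e\<^sub>3 = 0" "B e\<^sub>4 e\<^sub>1 = 1" "B e\<^sub>3 e\<^sub>2 = -1"
  using assms sym[of e\<^sub>2 e\<^sub>1] sym[of e\<^sub>3 e\<^sub>1] sym[of e\<^sub>4 e\<^sub>2] sym[of e\<^sub>4 e\<^sub>3] sym[of e\<^sub>4 e\<^sub>1] sym[of e\<^sub>3 e\<^sub>2]
  unfolding hyperbolic_def by simp_all

lemma hyperbolic_expand:
  assumes "hyperbolic e\<^sub>1 e\<^sub>2 e\<^sub>3 e\<^sub>4"
  obtains a b c d where "v = a *s e\<^sub>1 + b *s e\<^sub>2 + c *s e\<^sub>3 + d *s e\<^sub>4"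
proof (rule four_independent_span)
  note tab = hyperbolic_table[OF assms]
  fix a b c d assume eq: "a *s e\<^sub>1 + b *s e\<^sub>2 + c *s e\<^sub>3 + d *s e\<^sub>4 = 0"
  have *: "B (a *s e\<^sub>1 + b *s e\<^sub>2 + c *s e\<^sub>3 + d *s e\<^sub>4) w = 0" for w unfolding eq by simp
  show "a = 0 \<and> b = 0 \<and> c = 0 \<and> d = 0"
    using *[of e\<^sub>1] *[of e\<^sub>2] *[of e\<^sub>3] *[of e\<^sub>4] by (simp add: B_bilinear tab)
qed (rule that)


text \<open>An isotropic vector \<open>e\<^sub>1\<close> has a partner \<open>e\<^sub>4\<close> with product 1, which can be made isotropic by
  subtracting a multiple of \<open>e\<^sub>1\<close>. The form is nondegenerate on the orthogonal complement of these
  two vectors, and the same construction there gives \<open>e\<^sub>2\<close> and \<open>e\<^sub>3\<close>.\<close>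

lemma hyperbolic_basis_exists:
  obtains e\<^sub>1 e\<^sub>2 e\<^sub>3 e\<^sub>4 where "hyperbolic e\<^sub>1 e\<^sub>2 e\<^sub>3 e\<^sub>4"
proof -
  obtain a b where ab: "a \<noteq> 0 \<or> b \<noteq> 0" and
    iso: "B (a *s axis 1 1 + b *s axis 2 1) (a *s axis 1 1 + b *s axis 2 1) = 0"
    by (rule isotropic_in_plane)
  define e\<^sub>1 where "e\<^sub>1 = a *s axis 1 1 + b *s (axis 2 1 :: complex^4)"
  have "e\<^sub>1 $ 1 = a" "e\<^sub>1 $ 2 = b" by (simp_all add: e\<^sub>1_def axis_def)
  then have "e\<^sub>1 \<noteq> 0" using ab by auto
  have B11: "B e\<^sub>1 e\<^sub>1 = 0" using iso by (simp add: e\<^sub>1_def)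
  obtain y where y: "B e\<^sub>1 y \<noteq> 0" using nondegenerate \<open>e\<^sub>1 \<noteq> 0\<close> by blast
  define y' where "y' = (1 / B e\<^sub>1 y) *s y"
  have y': "B e\<^sub>1 y' = 1" using y by (simp add: y'_def B_bilinear)
  define e\<^sub>4 where "e\<^sub>4 = y' - (B y' y' / 2) *s e\<^sub>1"
  have B14: "B e\<^sub>1 e\<^sub>4 = 1" by (simp add: e\<^sub>4_def B_bilinear B11 y')
  have B44: "B e\<^sub>4 e\<^sub>4 = 0" using y' sym[of y' e\<^sub>1] by (simp add: e\<^sub>4_def B_bilinear B11)
  have B41: "B e\<^sub>4 e\<^sub>1 = 1" using B14 sym by simp
  \<comment> \<open>The orthogonal projection to the complement of \<open>e\<^sub>1\<close> and \<open>e\<^sub>4\<close>.\<close>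
  define pr where "pr x = x - B x e\<^sub>4 *s e\<^sub>1 - B x e\<^sub>1 *s e\<^sub>4" for x
  have pr1: "B (pr x) e\<^sub>1 = 0" and pr4: "B (pr x) e\<^sub>4 = 0" for x
    by (simp_all add: pr_def B_bilinear B11 B14 B44 B41)
  have prB: "B z (pr x) = B z x" if "B z e\<^sub>1 = 0" "B z e\<^sub>4 = 0" for z x
    using that by (simp add: pr_def B_bilinear)
  obtain x where x: "x \<notin> vec.span {e\<^sub>1, e\<^sub>4}"
    using vec_span_small[of "[e\<^sub>1, e\<^sub>4]"] by auto
  obtain z where z: "z \<notin> vec.span {x, e\<^sub>1, e\<^sub>4}"
    using vec_span_small[of "[x, e\<^sub>1, e\<^sub>4]"] by auto
  obtain a' b' where ab': "a' \<noteq> 0 \<or> b' \<noteq> 0" and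
    iso': "B (a' *s pr x + b' *s pr z) (a' *s pr x + b' *s pr z) = 0"
    by (rule isotropic_in_plane)
  define e\<^sub>2 where "e\<^sub>2 = a' *s pr x + b' *s pr z"
  have B22: "B e\<^sub>2 e\<^sub>2 = 0" using iso' by (simp add: e\<^sub>2_def)
  have B21: "B e\<^sub>2 e\<^sub>1 = 0" and B24: "B e\<^sub>2 e\<^sub>4 = 0" by (simp_all add: e\<^sub>2_def B_bilinear pr1 pr4)
  have "e\<^sub>2 \<noteq> 0"
  proof
    assume "e\<^sub>2 = 0"
    then have eq: "a' *s x + b' *s z = (a' * B x e\<^sub>4 + b' * B z e\<^sub>4) *s e\<^sub>1 + (a' * B x e\<^sub>1 + b' * B z e\<^sub>1) *s e\<^sub>4"
      by (simp add: e\<^sub>2_def pr_def vec_eq_iff algebra_simps)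
    then have mem: "a' *s x + b' *s z \<in> vec.span {e\<^sub>1, e\<^sub>4}"
      unfolding eq by (intro vec.span_add vec.span_scale vec.span_base) auto
    show False
    proof (cases "b' = 0")
      case True
      then have a': "a' \<noteq> 0" and a'x: "a' *s x \<in> vec.span {e\<^sub>1, e\<^sub>4}" using ab' mem by auto
      have "(1/a') *s (a' *s x) \<in> vec.span {e\<^sub>1, e\<^sub>4}" using a'x by (rule vec.span_scale)
      then show False using x a' by simp
    next
      case False
      have "a' *s x + b' *s z \<in> vec.span {x, e\<^sub>1, e\<^sub>4}" using mem vec.span_mono[of "{e\<^sub>1,e\<^sub>4}" "{x,e\<^sub>1,e\<^sub>4}"] by auto
      moreover have "a' *s x \<in> vec.span {x, e\<^sub>1, e\<^sub>4}" by (intro vec.span_scale vec.span_base) simp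
      ultimately have "b' *s z \<in> vec.span {x, e\<^sub>1, e\<^sub>4}" by (metis add_diff_cancel_left' vec.span_diff)
      then have "(1/b') *s (b' *s z) \<in> vec.span {x, e\<^sub>1, e\<^sub>4}" by (rule vec.span_scale)
      then show False using z False by simp
    qed
  qed
  then obtain t where t: "B e\<^sub>2 t \<noteq> 0" using nondegenerate by blast
  define t' where "t' = (- 1 / B e\<^sub>2 t) *s pr t"
  have t': "B e\<^sub>2 t' = -1" using t by (simp add: t'_def B_bilinear prB[OF B21 B24])
  have t'1: "B t' e\<^sub>1 = 0" "B t' e\<^sub>4 = 0" by (simp_all add: t'_def B_bilinear pr1 pr4)
  define e\<^sub>3 where "e\<^sub>3 = t' + (B t' t' / 2) *s e\<^sub>2"
  have B23: "B e\<^sub>2 e\<^sub>3 = -1" by (simp add: e\<^sub>3_def B_bilinear t' B22)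
  have B33: "B e\<^sub>3 e\<^sub>3 = 0" using t' sym[of t' e\<^sub>2] by (simp add: e\<^sub>3_def B_bilinear B22)
  have B31: "B e\<^sub>3 e\<^sub>1 = 0" and B34: "B e\<^sub>3 e\<^sub>4 = 0" by (simp_all add: e\<^sub>3_def B_bilinear t'1 B21 B24)
  have others: "B e\<^sub>1 e\<^sub>2 = 0" "B e\<^sub>1 e\<^sub>3 = 0" "B e\<^sub>4 e\<^sub>2 = 0" "B e\<^sub>4 e\<^sub>3 = 0" "B e\<^sub>3 e\<^sub>2 = -1"
    using B21 B31 B24 B34 B23 sym by metis+
  note tab = B11 B22 B33 B44 B14 B41 B21 B24 B23 B31 B34 others
  have "hyperbolic e\<^sub>1 e\<^sub>2 e\<^sub>3 e\<^sub>4"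
    unfolding hyperbolic_def using tab by blast
  then show ?thesis by (rule that)
qed


text \<open>A quadratic form that vanishes on a smooth quadric is a multiple of its equation. In a hyperbolic
  basis, the isotropic basis vectors and the isotropic planes that they span kill all coefficients
  except those of \<open>x\<^sub>1 x\<^sub>4\<close> and \<open>x\<^sub>2 x\<^sub>3\<close>, and the isotropic vector \<open>e\<^sub>1 + e\<^sub>2 + e\<^sub>3 + e\<^sub>4\<close> relates
  these two. The statement is the polarised one.\<close>

lemma quadric_vanishing_on_isotropic:
  assumes \<beta>: "bilinear_form \<beta>" and vanish: "\<And>v. B v v = 0 \<Longrightarrow> \<beta> v v = 0"
  shows "\<exists>c. \<forall>v w. \<beta> v w + \<beta> w v = c * B v w"
proof -
  obtain e\<^sub>1 e\<^sub>2 e\<^sub>3 e\<^sub>4 where hyp: "hyperbolic e\<^sub>1 e\<^sub>2 e\<^sub>3 e\<^sub>4" by (rule hyperbolic_basis_exists)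
  note tab = hyperbolic_table[OF hyp] and co = hyperbolic_expand[OF hyp]
  define s where "s v w = \<beta> v w + \<beta> w v" for v w
  have s_add: "s (u + v) w = s u w + s v w" "s w (u + v) = s w u + s w v"
    and s_scale: "s (c *s v) w = c * s v w" "s w (c *s v) = c * s w v" for u v w c
    using \<beta> by (simp_all add: s_def bilinear_form_def algebra_simps)
  have s_sym: "s v w = s w v" for v w by (simp add: s_def)
  have s0: "s v v = 0" if "B v v = 0" for v using vanish that by (simp add: s_def)
  have pair: "s v w = 0" if "B v v = 0" "B w w = 0" "B v w = 0" for v w
    using s0[of "v + w"] s0[of v] s0[of w] that s_sym[of w v] sym[of w v]
    by (simp add: s_add B_bilinear)
  have stab: "s e\<^sub>1 e\<^sub>1 = 0" "s e\<^sub>2 e\<^sub>2 = 0" "s e\<^sub>3 e\<^sub>3 = 0" "s e\<^sub>4 e\<^sub>4 = 0"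
    "s e\<^sub>1 e\<^sub>2 = 0" "s e\<^sub>1 e\<^sub>3 = 0" "s e\<^sub>2 e\<^sub>4 = 0" "s e\<^sub>3 e\<^sub>4 = 0"
    "s e\<^sub>2 e\<^sub>1 = 0" "s e\<^sub>3 e\<^sub>1 = 0" "s e\<^sub>4 e\<^sub>2 = 0" "s e\<^sub>4 e\<^sub>3 = 0"
    using tab by (auto intro!: pair)
  have "s (e\<^sub>1 + e\<^sub>2 + e\<^sub>3 + e\<^sub>4) (e\<^sub>1 + e\<^sub>2 + e\<^sub>3 + e\<^sub>4) = 0"
    by (rule s0) (simp add: B_bilinear tab)
  then have "2 * s e\<^sub>2 e\<^sub>3 = - (2 * s e\<^sub>1 e\<^sub>4)"
    using s_sym[of e\<^sub>4 e\<^sub>1] s_sym[of e\<^sub>3 e\<^sub>2] by (simp add: s_add stab eq_neg_iff_add_eq_0 algebra_simps)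
  then have s23: "s e\<^sub>2 e\<^sub>3 = - s e\<^sub>1 e\<^sub>4" by (simp only: mult_minus_right[symmetric] mult_cancel_left) simp
  have s32: "s e\<^sub>3 e\<^sub>2 = - s e\<^sub>1 e\<^sub>4" and s41: "s e\<^sub>4 e\<^sub>1 = s e\<^sub>1 e\<^sub>4"
    using s23 s_sym by metis+
  have "s v w = s e\<^sub>1 e\<^sub>4 * B v w" for v w
  proof -
    obtain a b c d where v: "v = a *s e\<^sub>1 + b *s e\<^sub>2 + c *s e\<^sub>3 + d *s e\<^sub>4"
      by (rule co)
    obtain a' b' c' d' where w: "w = a' *s e\<^sub>1 + b' *s e\<^sub>2 + c' *s e\<^sub>3 + d' *s e\<^sub>4"
      by (rule co)
    show ?thesis unfolding v w
      by (simp add: s_add s_scale stab s23 s32 s41 B_bilinear tab algebra_simps)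
  qed
  then show ?thesis unfolding s_def by blast
qed

text \<open>An isotropic vector with coordinates \<open>a, b, c, d\<close> satisfies \<open>a d = b c\<close>. For \<open>a \<noteq> 0\<close> it is therefore a combination
  of \<open>a e\<^sub>1 + b e\<^sub>2\<close> and \<open>a e\<^sub>3 + b e\<^sub>4\<close>, which span an isotropic plane, and the basis
  vectors within each of them span another; if \<open>a = 0\<close>, it already lies in a plane of the basis.\<close>

lemma linear_of_linear_on_isotropic_planes:
  assumes f: "\<And>u w a b. B u u = 0 \<Longrightarrow> B w w = 0 \<Longrightarrow> B u w = 0 \<Longrightarrow> f (a *s u + b *s w) = a * f u + b * f w"
  shows "\<exists>m. \<forall>v. B v v = 0 \<longrightarrow> f v = B v m"
proof -
  obtain e\<^sub>1 e\<^sub>2 e\<^sub>3 e\<^sub>4 where hyp: "hyperbolic e\<^sub>1 e\<^sub>2 e\<^sub>3 e\<^sub>4" by (rule hyperbolic_basis_exists)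
  note tab = hyperbolic_table[OF hyp] and co = hyperbolic_expand[OF hyp]
  define m where "m = f e\<^sub>1 *s e\<^sub>4 + f e\<^sub>4 *s e\<^sub>1 - f e\<^sub>2 *s e\<^sub>3 - f e\<^sub>3 *s e\<^sub>2"
  have "f v = B v m" if "B v v = 0" for v
  proof -
    obtain a b c d where v: "v = a *s e\<^sub>1 + b *s e\<^sub>2 + c *s e\<^sub>3 + d *s e\<^sub>4"
      by (rule co)
    have m: "B v m = a * f e\<^sub>1 + b * f e\<^sub>2 + c * f e\<^sub>3 + d * f e\<^sub>4"
      unfolding v m_def by (simp add: B_bilinear tab algebra_simps)
    have "2 * (a * d - b * c) = 0"
      using that unfolding v by (simp add: B_bilinear tab algebra_simps)
    then have ad: "a * d = b * c" by simp
    consider "a \<noteq> 0" | "a = 0" "b = 0" | "a = 0" "c = 0"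
      using ad by (cases "a = 0"; cases "b = 0") auto
    then show ?thesis
    proof cases
      case 1
      have "v = 1 *s (a *s e\<^sub>1 + b *s e\<^sub>2) + (c / a) *s (a *s e\<^sub>3 + b *s e\<^sub>4)"
        using 1 ad unfolding v by (simp add: vec_eq_iff field_simps)
      also have "f \<dots> = 1 * f (a *s e\<^sub>1 + b *s e\<^sub>2) + (c / a) * f (a *s e\<^sub>3 + b *s e\<^sub>4)"
        by (rule f) (simp_all add: B_bilinear tab)
      also have "f (a *s e\<^sub>1 + b *s e\<^sub>2) = a * f e\<^sub>1 + b * f e\<^sub>2" by (rule f) (simp_all add: tab)
      also have "f (a *s e\<^sub>3 + b *s e\<^sub>4) = a * f e\<^sub>3 + b * f e\<^sub>4" by (rule f) (simp_all add: tab)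
      finally have fv: "f v = a * f e\<^sub>1 + b * f e\<^sub>2 + c / a * (a * f e\<^sub>3 + b * f e\<^sub>4)" by simp
      have d: "d = c / a * b" using 1 ad by (simp add: field_simps)
      show ?thesis unfolding m fv d using 1 by (simp add: field_simps)
    next
      case 2
      have "f (c *s e\<^sub>3 + d *s e\<^sub>4) = c * f e\<^sub>3 + d * f e\<^sub>4" by (rule f) (simp_all add: tab)
      then show ?thesis unfolding m by (simp add: v 2)
    next
      case 3
      have "f (b *s e\<^sub>2 + d *s e\<^sub>4) = b * f e\<^sub>2 + d * f e\<^sub>4" by (rule f) (simp_all add: tab)
      then show ?thesis unfolding m by (simp add: v 3)
    qed
  qed
  then show ?thesis by blast
qed

lemma linear_vanishing_on_isotropic:
  assumes "\<And>u v. f (u + v) = f u + f v" "\<And>c v. f (c *s v) = c * f v"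
    and "\<And>v. B v v = 0 \<Longrightarrow> f v = (0 :: complex)"
  shows "f v = 0"
proof -
  obtain e\<^sub>1 e\<^sub>2 e\<^sub>3 e\<^sub>4 where hyp: "hyperbolic e\<^sub>1 e\<^sub>2 e\<^sub>3 e\<^sub>4" by (rule hyperbolic_basis_exists)
  then have "f e\<^sub>1 = 0" "f e\<^sub>2 = 0" "f e\<^sub>3 = 0" "f e\<^sub>4 = 0"
    using assms(3) unfolding hyperbolic_def by blast+
  moreover obtain a b c d where "v = a *s e\<^sub>1 + b *s e\<^sub>2 + c *s e\<^sub>3 + d *s e\<^sub>4"
    using hyp by (rule hyperbolic_expand)
  ultimately show ?thesis by (simp add: assms(1,2))
qed

text \<open>This is the linear algebra behind the theorem. The quadrics \<open>\<tau> u v v\<close> in \<open>v\<close> and \<open>\<tau> v v w\<close> in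
  \<open>v\<close> vanish on the isotropic cone, so they are multiples of the form; both multiples turn out to
  be 0, hence \<open>\<tau>\<close> is alternating. It is annihilated by \<open>p\<close> in the first argument and by \<open>p'\<close> in
  the last, so it descends to the quotient by the plane that they span. That quotient is
  two-dimensional and carries no nonzero alternating trilinear form.\<close>

lemma trilinear_vanishes:
  assumes lin12: "\<And>w. bilinear_form (\<lambda>u v. \<tau> u v w)" and lin23: "\<And>u. bilinear_form (\<tau> u)"
    and tangent: "\<And>u v. B v v = 0 \<Longrightarrow> \<tau> u v v = 0"
    and hyperplane: "\<And>u v. \<tau> u v p' = 0"
    and pole: "\<And>u w. B p' p' = 0 \<Longrightarrow> \<tau> u p' w = 0"
    and relation: "\<And>v w. B v v = 0 \<Longrightarrow> \<tau> v v w = 0"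
    and kernel: "\<And>v w. \<tau> p v w = 0"
    and indep: "\<And>a b. a *s p + b *s p' = 0 \<Longrightarrow> a = 0 \<and> b = 0"
  shows "\<tau> u v w = 0"
proof -
  have add: "\<tau> (u + u') v w = \<tau> u v w + \<tau> u' v w" "\<tau> u (v + v') w = \<tau> u v w + \<tau> u v' w"
    "\<tau> u v (w + w') = \<tau> u v w + \<tau> u v w'"
    and scale: "\<tau> (c *s u) v w = c * \<tau> u v w" "\<tau> u (c *s v) w = c * \<tau> u v w"
    "\<tau> u v (c *s w) = c * \<tau> u v w" for u v w u' v' w' c
    using bilinear_formD[OF lin12] bilinear_formD[OF lin23] by simp_all
  have "p' \<noteq> 0" using indep[of 0 1] by auto
  \<comment> \<open>If the pole is off the quadric, the multiple is found at the pole; if it is on it, by polarising there.\<close>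
  have skew23: "\<tau> u v w = - \<tau> u w v" for u v w
  proof -
    obtain c where c: "\<And>v w. \<tau> u v w + \<tau> u w v = c * B v w"
      using quadric_vanishing_on_isotropic[OF lin23[of u] tangent[of _ u]] by blast
    have "c = 0"
    proof (cases "B p' p' = 0")
      case True
      obtain w where "B p' w \<noteq> 0" using nondegenerate \<open>p' \<noteq> 0\<close> by blast
      then show ?thesis using c[of p' w] pole[OF True] hyperplane by simp
    next
      case False
      then show ?thesis using c[of p' p'] hyperplane by simp
    qed
    then show ?thesis using c[of v w] by (simp add: eq_neg_iff_add_eq_0)
  qed
  have diag23: "\<tau> u w w = 0" for u w
    using skew23[of u w w] by (simp add: eq_neg_iff_add_eq_0)
  have "\<exists>c. \<forall>u v. \<tau> u v w + \<tau> v u w = c * B u v" for w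
    by (rule quadric_vanishing_on_isotropic[OF lin12[of w] relation])
  then have "\<exists>d. \<forall>w u v. \<tau> u v w + \<tau> v u w = d w * B u v"
    by (intro choice allI)
  then obtain d where d: "\<And>w u v. \<tau> u v w + \<tau> v u w = d w * B u v" by blast
  \<comment> \<open>The two symmetries together compare the multiples at different arguments.\<close>
  have dd: "2 * d w * B u w = - (d u * B w w)" for u w
  proof -
    have "d w * B u w = - \<tau> w w u" using d[of u w w] skew23[of w u w] by (simp add: diag23)
    moreover have "2 * \<tau> w w u = d u * B w w" using d[of w w u] by simp
    ultimately show ?thesis by (simp only: mult.assoc mult_minus_right)
  qed
  have d0: "d u = 0" for u
  proof -
    obtain e\<^sub>1 e\<^sub>2 e\<^sub>3 e\<^sub>4 where "hyperbolic e\<^sub>1 e\<^sub>2 e\<^sub>3 e\<^sub>4" by (rule hyperbolic_basis_exists)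
    then have w: "B (e\<^sub>1 + e\<^sub>4) (e\<^sub>1 + e\<^sub>4) = 2" using sym[of e\<^sub>4 e\<^sub>1] by (simp add: hyperbolic_def B_bilinear)
    then have "d (e\<^sub>1 + e\<^sub>4) = 0" using dd[of "e\<^sub>1 + e\<^sub>4" "e\<^sub>1 + e\<^sub>4"] by simp
    then show ?thesis using dd[of "e\<^sub>1 + e\<^sub>4" u] w by simp
  qed
  have skew12: "\<tau> u v w = - \<tau> v u w" for u v w
    using d[of u v w] by (simp add: d0 eq_neg_iff_add_eq_0)
  have diag12: "\<tau> u u w = 0" for u w
    using skew12[of u u w] by (simp add: eq_neg_iff_add_eq_0)
  have diag13: "\<tau> u v u = 0" for u v
    using skew12[of u v u] diag23 by simp
  have p2: "\<tau> u p w = 0" and p'2: "\<tau> u p' w = 0" for u w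
    using skew12[of u p w] kernel skew23[of u p' w] hyperplane by simp_all
  have p3: "\<tau> u v p = 0" and p'1: "\<tau> p' v w = 0" for u v w
    using skew23[of u v p] p2 skew12[of p' v w] p'2 by simp_all
  obtain x where x: "x \<notin> vec.span {p, p'}" using vec_span_small[of "[p, p']"] by auto
  obtain y where y: "y \<notin> vec.span {p, p', x}" using vec_span_small[of "[p, p', x]"] by auto
  have ind4: "a = 0 \<and> b = 0 \<and> c = 0 \<and> d = 0" if eq: "a *s p + b *s p' + c *s x + d *s y = 0" for a b c d
  proof -
    have d: "d = 0"
    proof (rule ccontr)
      assume "d \<noteq> 0"
      have "a *s p + b *s p' + c *s x \<in> vec.span {p, p', x}"
        by (intro vec.span_add vec.span_scale vec.span_base) auto
      moreover have "d *s y = - (a *s p + b *s p' + c *s x)"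
        using minus_unique[OF eq] by (rule HOL.sym)
      ultimately have "d *s y \<in> vec.span {p, p', x}" using vec.span_neg by metis
      then have "(1 / d) *s (d *s y) \<in> vec.span {p, p', x}" by (rule vec.span_scale)
      then show False using y \<open>d \<noteq> 0\<close> by simp
    qed
    have c: "c = 0"
    proof (rule ccontr)
      assume "c \<noteq> 0"
      have "a *s p + b *s p' \<in> vec.span {p, p'}"
        by (intro vec.span_add vec.span_scale vec.span_base) auto
      moreover have "c *s x = - (a *s p + b *s p')"
        using minus_unique[of "a *s p + b *s p'" "c *s x"] eq d by simp
      ultimately have "c *s x \<in> vec.span {p, p'}" using vec.span_neg by metis
      then have "(1 / c) *s (c *s x) \<in> vec.span {p, p'}" by (rule vec.span_scale)
      then show False using x \<open>c \<noteq> 0\<close> by simp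
    qed
    show ?thesis using indep[of a b] eq by (simp add: c d)
  qed
  obtain a\<^sub>1 b\<^sub>1 c\<^sub>1 d\<^sub>1 where u: "u = a\<^sub>1 *s p + b\<^sub>1 *s p' + c\<^sub>1 *s x + d\<^sub>1 *s y"
    using ind4 by (rule four_independent_span)
  obtain a\<^sub>2 b\<^sub>2 c\<^sub>2 d\<^sub>2 where v: "v = a\<^sub>2 *s p + b\<^sub>2 *s p' + c\<^sub>2 *s x + d\<^sub>2 *s y"
    using ind4 by (rule four_independent_span)
  obtain a\<^sub>3 b\<^sub>3 c\<^sub>3 d\<^sub>3 where w: "w = a\<^sub>3 *s p + b\<^sub>3 *s p' + c\<^sub>3 *s x + d\<^sub>3 *s y"
    using ind4 by (rule four_independent_span)
  show ?thesis
    unfolding u v w by (simp add: add scale kernel hyperplane p2 p3 p'1 p'2 diag12 diag13 diag23)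
qed

end


section \<open>Sections of twisting sheaves on lines\<close>

lemma cone_iff: "v \<in> cone U \<longleftrightarrow> v \<noteq> 0 \<and> vec.span {v} \<in> U"
  by (simp add: cone_def)

lemma cone_Int: "cone (U \<inter> W) = cone U \<inter> cone W"
  by (auto simp: cone_def)

lemma cone_scale:
  assumes "c \<noteq> 0" shows "c *s v \<in> cone U \<longleftrightarrow> v \<in> cone U"
proof -
  have "vec.span {c *s v} = vec.span {v}"
    using vec.span_image_scale[of "{v}" "\<lambda>_. c"] assms by simp
  then show ?thesis using assms by (simp add: cone_iff)
qed

lemma cone_vanishing:
  assumes "homogeneous d f"
  shows "v \<in> cone (vanishing f) \<longleftrightarrow> v \<noteq> 0 \<and> peval f v = 0"
  using span_in_vanishing_iff[OF assms] by (auto simp: cone_iff)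

lemma continuous_on_peval: "continuous_on S (peval f)"
  unfolding peval_def by (intro continuous_intros)

lemma open_cone:
  assumes "zariski_open U"
  shows "open (cone U)"
proof -
  obtain S where S: "\<forall>f\<in>S. \<exists>d. homogeneous d f" and U: "U = proj3 - (\<Inter>f\<in>S. vanishing f)"
    using assms unfolding zariski_open_def by blast
  have "v \<in> cone U \<longleftrightarrow> v \<in> (\<Union>f\<in>S. {v. v \<noteq> 0 \<and> peval f v \<noteq> 0})" for v
    using S span_in_vanishing_iff[of _ _ v] unfolding U cone_iff proj3_def by blast
  then have "cone U = (\<Union>f\<in>S. {v. v \<noteq> 0 \<and> peval f v \<noteq> 0})" by blast
  moreover have "open {v. v \<noteq> 0 \<and> peval f v \<noteq> 0}" for f
    by (intro open_Collect_conj open_Collect_neq continuous_intros continuous_on_peval)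
  ultimately show ?thesis by auto
qed

text \<open>The domain of the quotient is given here by an open subset of the whole projective space, whose
  cone is open in the Euclidean topology; this is what brings complex analysis into play.\<close>

lemma twist_local:
  assumes "s \<in> twist X d U" "v \<in> cone U"
  obtains W a b e where "zariski_open W" "v \<in> cone W" "v \<in> cone X"
    "homogeneous (d + e) a" "homogeneous e b"
    "\<And>w. w \<in> cone W \<Longrightarrow> w \<in> cone X \<Longrightarrow> peval b w \<noteq> 0 \<and> s w = peval a w / peval b w"
proof -
  have "vec.span {v} \<in> U" using assms(2) by (simp add: cone_iff)
  then obtain W' a b e where W': "openin (subtopology zariski X) W'" "vec.span {v} \<in> W'" "W' \<subseteq> U"
    and hom: "homogeneous (d + e) a" "homogeneous e b"
    and eq: "\<forall>v\<in>cone W'. peval b v \<noteq> 0 \<and> s v = peval a v / peval b v"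
    using assms(1) unfolding twist_def by blast
  obtain W where W: "zariski_open W" "W' = W \<inter> X"
    using W'(1) by (auto simp: openin_subtopology openin_zariski)
  show ?thesis
  proof (rule that[OF W(1) _ _ hom])
    show "v \<in> cone W" "v \<in> cone X"
      using W' W(2) assms(2) by (auto simp: cone_iff)
    fix w assume "w \<in> cone W" "w \<in> cone X"
    then show "peval b w \<noteq> 0 \<and> s w = peval a w / peval b w"
      using eq W(2) by (simp add: cone_Int)
  qed
qed

lemma twist_scale:
  assumes s: "s \<in> twist X d U" and v: "v \<in> cone U" and c: "c \<noteq> 0"
  shows "s (c *s v) = c ^ d * s v"
proof -
  obtain W a b e where W: "v \<in> cone W" "v \<in> cone X" and hom: "homogeneous (d + e) a" "homogeneous e b"
    and eq: "\<And>w. w \<in> cone W \<Longrightarrow> w \<in> cone X \<Longrightarrow> peval b w \<noteq> 0 \<and> s w = peval a w / peval b w"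
    using twist_local[OF s v] by metis
  have "s (c *s v) = peval a (c *s v) / peval b (c *s v)"
    using eq[of "c *s v"] W cone_scale[OF c] by simp
  also have "\<dots> = c ^ d * (peval a v / peval b v)"
    using c by (simp add: peval_scale[OF hom(1)] peval_scale[OF hom(2)] power_add)
  also have "\<dots> = c ^ d * s v" using eq[of v] W by simp
  finally show ?thesis .
qed

lemma holomorphic_peval_line: "(\<lambda>z. peval f (u + z *s w)) holomorphic_on S"
  unfolding peval_def by (auto intro!: holomorphic_intros)

lemma open_line_in_cone:
  assumes "zariski_open W"
  shows "open {z. u + z *s w \<in> cone W}"
proof -
  have "(\<lambda>z. u + z *s w) = (\<lambda>z. \<chi> i. u $ i + z * w $ i)"
    by (simp add: fun_eq_iff vec_eq_iff)
  moreover have "continuous_on UNIV (\<lambda>z. \<chi> i. u $ i + z * w $ i)"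
    by (intro continuous_intros)
  ultimately have "continuous_on UNIV (\<lambda>z. u + z *s w)" by (simp only:)
  then show ?thesis
    using open_vimage[OF open_cone[OF assms]] by (simp add: vimage_def)
qed

text \<open>The line is only required to stay in the cone over \<open>X\<close> near \<open>z\<close>. For lines on the quadric this
  holds globally, while lines through the pole of the hyperplane are only used locally.\<close>

lemma twist_line_differentiable:
  assumes s: "s \<in> twist X d U" and z: "u + z *s w \<in> cone U"
    and T: "open T" "z \<in> T" and line: "\<And>z. z \<in> T \<Longrightarrow> u + z *s w \<in> cone X"
  shows "(\<lambda>z. s (u + z *s w)) field_differentiable (at z)"
proof -
  obtain W a b e where W: "zariski_open W" "u + z *s w \<in> cone W"
    and eq: "\<And>w. w \<in> cone W \<Longrightarrow> w \<in> cone X \<Longrightarrow> peval b w \<noteq> 0 \<and> s w = peval a w / peval b w"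
    using twist_local[OF s z] by metis
  let ?T = "{z. u + z *s w \<in> cone W} \<inter> T"
  have "(\<lambda>z. peval a (u + z *s w) / peval b (u + z *s w)) holomorphic_on ?T"
    using eq line by (intro holomorphic_on_divide holomorphic_peval_line) auto
  then have "(\<lambda>z. s (u + z *s w)) holomorphic_on ?T"
    using eq line by (subst holomorphic_cong[OF refl]) auto
  moreover have "open ?T" using T(1) open_line_in_cone[OF W(1)] by blast
  ultimately show ?thesis using T(2) W(2) by (auto simp: holomorphic_on_open field_differentiable_def)
qed

text \<open>Boundedness of \<open>k\<close> on the unit disc bounds \<open>h\<close> linearly outside it, so that the polynomial version
  of Liouville's theorem applies.\<close>

lemma affine_of_reciprocal_growth:
  assumes h: "h holomorphic_on UNIV" and k: "k holomorphic_on UNIV"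
    and hk: "\<And>z. z \<noteq> 0 \<Longrightarrow> h z = z * k (1 / z)"
  shows "h z = h 0 + z * deriv h 0"
proof -
  have "compact (k ` cball 0 1)"
    by (intro compact_continuous_image holomorphic_on_imp_continuous_on
        holomorphic_on_subset[OF k]) auto
  then obtain C where "\<forall>x\<in>k ` cball 0 1. norm x \<le> C"
    by (meson bounded_iff compact_imp_bounded)
  then have C: "norm (k z) \<le> C" if "norm z \<le> 1" for z
    using that by simp
  have "norm (h z) \<le> C * norm z ^ 1" if "1 \<le> norm z" for z
  proof -
    have "z \<noteq> 0" using that by auto
    have "norm (1 / z) \<le> 1"
      using that order.strict_trans2[OF zero_less_one that] by (simp add: norm_divide divide_le_eq_1_pos)
    then have "norm (k (1 / z)) * norm z \<le> C * norm z" using C by (intro mult_right_mono) auto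
    then show ?thesis using hk[OF \<open>z \<noteq> 0\<close>] by (simp add: norm_mult mult.commute)
  qed
  then have "h z = (\<Sum>k\<le>1. (deriv ^^ k) h 0 / fact k * z ^ k)"
    by (rule Liouville_polynomial[OF h, of 1 C 1])
  then show ?thesis by (simp add: mult.commute)
qed

text \<open>On the affine line \<open>u + z w\<close> the section is entire, and homogeneity relates its growth at infinity
  to its behaviour near \<open>w\<close> on the line \<open>w + z u\<close>. This is the computation of the global sections
  of \<open>O(1)\<close> on a projective line.\<close>

lemma twist1_affine_on_line:
  assumes s: "s \<in> twist X 1 X"
    and plane: "\<And>a b. a \<noteq> 0 \<or> b \<noteq> 0 \<Longrightarrow> a *s u + b *s w \<in> cone X"
  shows "s (u + z *s w) = s u + z * s w"
proof -
  define h where "h z = s (u + z *s w)" for z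
  define k where "k z = s (w + z *s u)" for z
  have uw: "u + z *s w \<in> cone X" "w + z *s u \<in> cone X" for z
    using plane[of 1 z] plane[of z 1] by (simp_all add: add.commute)
  have h: "h holomorphic_on UNIV" and k: "k holomorphic_on UNIV"
    unfolding h_def k_def holomorphic_on_def
    using twist_line_differentiable[OF s uw(1) open_UNIV UNIV_I uw(1)]
      twist_line_differentiable[OF s uw(2) open_UNIV UNIV_I uw(2)]
    by simp_all
  have hk: "h z = z * k (1 / z)" if "z \<noteq> 0" for z
  proof -
    have eq: "u + z *s w = z *s (w + (1 / z) *s u)" using that by (simp add: vec_eq_iff field_simps)
    show ?thesis unfolding h_def k_def eq using twist_scale[OF s uw(2) that] by (simp only: power_one_right)
  qed
  have kh: "k z = z * h (1 / z)" if "z \<noteq> 0" for z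
    using hk[of "1 / z"] that by simp
  note H = affine_of_reciprocal_growth[OF h k hk] and K = affine_of_reciprocal_growth[OF k h kh]
  have "h 0 + deriv h 0 = k 0 + deriv k 0" using hk[of 1] H[of 1] K[of 1] by simp
  moreover have "h 0 - deriv h 0 = deriv k 0 - k 0" using hk[of "-1"] H[of "-1"] K[of "-1"] by simp
  ultimately have "(h 0 + deriv h 0) - (h 0 - deriv h 0) = (k 0 + deriv k 0) - (deriv k 0 - k 0)"
    by (simp only:)
  then have "deriv h 0 = k 0" by simp
  then have "h z = h 0 + z * k 0" using H[of z] by simp
  then show ?thesis by (simp add: h_def k_def)
qed

lemma twist1_linear_on_plane:
  assumes s: "s \<in> twist X 1 X"
    and plane: "\<And>a b. a *s u + b *s w \<noteq> 0 \<Longrightarrow> a *s u + b *s w \<in> cone X"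
  shows "s (a *s u + b *s w) = a * s u + b * s w"
proof -
  have s0: "s 0 = 0" using s by (auto simp: twist_def cone_iff)
  have sc: "s (c *s v) = c * s v" if "v \<noteq> 0 \<Longrightarrow> v \<in> cone X" for c v
    using twist_scale[OF s, of v c] that s0 by (cases "c = 0 \<or> v = 0") auto
  have u: "u \<noteq> 0 \<Longrightarrow> u \<in> cone X" and w: "w \<noteq> 0 \<Longrightarrow> w \<in> cone X"
    using plane[of 1 0] plane[of 0 1] by simp_all
  consider "u = 0" | c where "w = c *s u" | "u \<noteq> 0" "\<And>c. w \<noteq> c *s u" by blast
  then show ?thesis
  proof cases
    case 1
    then show ?thesis using sc[OF w] s0 by simp
  next
    case 2
    have eq: "a *s u + b *s w = (a + b * c) *s u" unfolding 2 by (simp add: algebra_simps)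
    have "s (a *s u + b *s w) = (a + b * c) * s u" unfolding eq using u by (rule sc)
    moreover have "s w = c * s u" unfolding 2 using u by (rule sc)
    ultimately show ?thesis by (simp add: algebra_simps)
  next
    case 3
    have ne: "x *s u + y *s w \<noteq> 0" if "x \<noteq> 0 \<or> y \<noteq> 0" for x y
    proof
      assume eq: "x *s u + y *s w = 0"
      show False
      proof (cases "y = 0")
        case True
        then show False using eq that 3(1) by simp
      next
        case False
        then have "w = (- x / y) *s u"
          using eq by (simp add: vec_eq_iff field_simps eq_neg_iff_add_eq_0 add.commute)
        then show False using 3(2) by blast
      qed
    qed
    show ?thesis
    proof (cases "a = 0")
      case True
      then show ?thesis using sc[OF w] by simp
    next
      case False
      have "a *s u + b *s w = a *s (u + (b / a) *s w)" using False by (simp add: algebra_simps)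
      also have "s \<dots> = a * s (u + (b / a) *s w)"
        using plane[of 1 "b / a"] by (intro sc) simp
      also have "s (u + (b / a) *s w) = s u + b / a * s w"
        using plane ne by (intro twist1_affine_on_line[OF s]) blast
      finally have eq: "s (a *s u + b *s w) = a * (s u + b / a * s w)" .
      show ?thesis unfolding eq using False by (simp add: field_simps)
    qed
  qed
qed


section \<open>Sums and products of sections of twisting sheaves\<close>

lemma twistI:
  assumes U: "openin (subtopology zariski X) U" and ab: "homogeneous (d + e) a" "homogeneous e b"
    and out: "\<And>v. v \<notin> cone U \<Longrightarrow> s v = 0"
    and eq: "\<And>v. v \<in> cone U \<Longrightarrow> peval b v \<noteq> 0 \<and> s v = peval a v / peval b v"
  shows "s \<in> twist X d U"
  unfolding twist_def
proof (intro CollectI conjI allI impI ballI)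
  fix p assume p: "p \<in> U"
  show "\<exists>W a b e. openin (subtopology zariski X) W \<and> p \<in> W \<and> W \<subseteq> U \<and>
        homogeneous (d + e) a \<and> homogeneous e b \<and>
        (\<forall>v\<in>cone W. peval b v \<noteq> 0 \<and> s v = peval a v / peval b v)"
  proof (rule exI[of _ U], rule exI[of _ a], rule exI[of _ b], rule exI[of _ e], intro conjI)
    show "\<forall>v\<in>cone U. peval b v \<noteq> 0 \<and> s v = peval a v / peval b v" using eq by blast
  qed (use U p ab in simp_all)
qed (rule out)

lemma linear_in_twist:
  assumes U: "openin (subtopology zariski X) U"
    and f: "\<And>u v. f (u + v) = f u + f v" "\<And>c v. f (c *s v) = c * f v"
  shows "(\<lambda>v. if v \<in> cone U then f v else 0) \<in> twist X 1 U"
proof -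
  obtain a where a: "homogeneous 1 a" "\<And>v. peval a v = bdot (\<chi> j. f (axis j 1)) v"
    by (metis linear_form_poly)
  have "peval a v = f v" for v unfolding a(2) by (rule bdot_expand[OF f, symmetric])
  then show ?thesis
    by (intro twistI[OF U, where a = a and b = 1 and e = 0]) (simp_all add: a(1)[simplified])
qed

lemma constant_in_twist:
  assumes U: "openin (subtopology zariski X) U"
  shows "(\<lambda>v. if v \<in> cone U then c else 0) \<in> twist X 0 U"
proof -
  obtain a where a: "homogeneous 0 a" "\<And>v. peval a v = c" by (metis constant_poly)
  show ?thesis
    by (rule twistI[OF U, where a = a and b = 1 and e = 0]) (use a in simp_all)
qed

lemma zero_in_twist:
  assumes U: "openin (subtopology zariski X) U"
  shows "(\<lambda>v. 0) \<in> twist X d U"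
  by (rule twistI[OF U, where a = 0 and b = 1 and e = 0]) (simp_all add: homogeneous_def)

lemma twist_add:
  assumes "s \<in> twist X d U" "t \<in> twist X d U"
  shows "(\<lambda>v. s v + t v) \<in> twist X d U"
proof -
  have out: "\<forall>v. v \<notin> cone U \<longrightarrow> s v + t v = 0" using assms by (simp add: twist_def)
  have "\<exists>W a b e. openin (subtopology zariski X) W \<and> p \<in> W \<and> W \<subseteq> U \<and>
        homogeneous (d + e) a \<and> homogeneous e b \<and>
        (\<forall>v\<in>cone W. peval b v \<noteq> 0 \<and> s v + t v = peval a v / peval b v)" if p: "p \<in> U" for p
  proof -
    obtain W a b e where 1: "openin (subtopology zariski X) W" "p \<in> W" "W \<subseteq> U"
      "homogeneous (d + e) a" "homogeneous e b" "\<forall>v\<in>cone W. peval b v \<noteq> 0 \<and> s v = peval a v / peval b v"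
      using assms(1) p unfolding twist_def by blast
    obtain W' a' b' e' where 2: "openin (subtopology zariski X) W'" "p \<in> W'" "W' \<subseteq> U"
      "homogeneous (d + e') a'" "homogeneous e' b'" "\<forall>v\<in>cone W'. peval b' v \<noteq> 0 \<and> t v = peval a' v / peval b' v"
      using assms(2) p unfolding twist_def by blast
    have "homogeneous (d + (e + e')) (a * b' + a' * b)"
      using homogeneous_mult[OF 1(4) 2(5)] homogeneous_mult[OF 2(4) 1(5)]
      by (intro homogeneous_add) (simp_all add: ac_simps)
    moreover have "\<forall>v\<in>cone (W \<inter> W'). peval (b * b') v \<noteq> 0 \<and>
        s v + t v = peval (a * b' + a' * b) v / peval (b * b') v"
      using 1(6) 2(6) by (simp add: cone_Int peval_mult peval_add add_frac_eq)
    moreover have "p \<in> W \<inter> W'" "W \<inter> W' \<subseteq> U" using 1(2,3) 2(2) by blast+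
    ultimately show ?thesis using openin_Int[OF 1(1) 2(1)] homogeneous_mult[OF 1(5) 2(5)] by blast
  qed
  with out show ?thesis unfolding twist_def by simp
qed

lemma twist_mult:
  assumes "s \<in> twist X d U" "t \<in> twist X d' U"
  shows "(\<lambda>v. s v * t v) \<in> twist X (d + d') U"
proof -
  have out: "\<forall>v. v \<notin> cone U \<longrightarrow> s v * t v = 0" using assms by (simp add: twist_def)
  have "\<exists>W a b e. openin (subtopology zariski X) W \<and> p \<in> W \<and> W \<subseteq> U \<and>
        homogeneous (d + d' + e) a \<and> homogeneous e b \<and>
        (\<forall>v\<in>cone W. peval b v \<noteq> 0 \<and> s v * t v = peval a v / peval b v)" if p: "p \<in> U" for p
  proof -
    obtain W a b e where 1: "openin (subtopology zariski X) W" "p \<in> W" "W \<subseteq> U"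
      "homogeneous (d + e) a" "homogeneous e b" "\<forall>v\<in>cone W. peval b v \<noteq> 0 \<and> s v = peval a v / peval b v"
      using assms(1) p unfolding twist_def by blast
    obtain W' a' b' e' where 2: "openin (subtopology zariski X) W'" "p \<in> W'" "W' \<subseteq> U"
      "homogeneous (d' + e') a'" "homogeneous e' b'" "\<forall>v\<in>cone W'. peval b' v \<noteq> 0 \<and> t v = peval a' v / peval b' v"
      using assms(2) p unfolding twist_def by blast
    have "homogeneous (d + d' + (e + e')) (a * a')"
      using homogeneous_mult[OF 1(4) 2(4)] by (simp add: ac_simps)
    moreover have "\<forall>v\<in>cone (W \<inter> W'). peval (b * b') v \<noteq> 0 \<and>
        s v * t v = peval (a * a') v / peval (b * b') v"
      using 1(6) 2(6) by (simp add: cone_Int peval_mult)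
    moreover have "p \<in> W \<inter> W'" "W \<inter> W' \<subseteq> U" using 1(2,3) 2(2) by blast+
    ultimately show ?thesis using openin_Int[OF 1(1) 2(1)] homogeneous_mult[OF 1(5) 2(5)] by blast
  qed
  with out show ?thesis unfolding twist_def by simp
qed

lemma twist_sum:
  assumes "openin (subtopology zariski X) U" "finite K" "\<And>k. k \<in> K \<Longrightarrow> s k \<in> twist X d U"
  shows "(\<lambda>v. \<Sum>k\<in>K. s k v) \<in> twist X d U"
  using assms(2,3)
proof (induction K rule: finite_induct)
  case empty
  show ?case using zero_in_twist[OF assms(1)] by simp
next
  case (insert k K)
  have "(\<lambda>v. s k v + (\<Sum>k\<in>K. s k v)) \<in> twist X d U"
    by (rule twist_add) (use insert in simp_all)
  then show ?case using insert.hyps by simp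
qed

section \<open>The triple vector product in four-space\<close>

lemma vec4_eqI:
  fixes x y :: "complex^4"
  assumes "x $ 1 = y $ 1" "x $ 2 = y $ 2" "x $ 3 = y $ 3" "x $ 4 = y $ 4"
  shows "x = y"
  using assms by (simp add: vec_eq_iff forall_4)

text \<open>The matrix that represents \<open>cross4 p u\<close> is skew-symmetric, with the dual Pluecker coordinates of
  the line through \<open>p\<close> and \<open>u\<close> as entries. Up to sign, \<open>bdot (cross4 p u v) w\<close> is the
  determinant of the four vectors.\<close>

definition pluecker :: "complex^4 \<Rightarrow> complex^4 \<Rightarrow> 4 \<Rightarrow> 4 \<Rightarrow> complex" where
  "pluecker p u i j = p $ i * u $ j - p $ j * u $ i"

definition cross4 :: "complex^4 \<Rightarrow> complex^4 \<Rightarrow> complex^4 \<Rightarrow> complex^4" where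
  "cross4 p u v = (\<chi> i.
     if i = 1 then pluecker p u 3 4 * v $ 2 - pluecker p u 2 4 * v $ 3 + pluecker p u 2 3 * v $ 4
     else if i = 2 then - pluecker p u 3 4 * v $ 1 + pluecker p u 1 4 * v $ 3 - pluecker p u 1 3 * v $ 4
     else if i = 3 then pluecker p u 2 4 * v $ 1 - pluecker p u 1 4 * v $ 2 + pluecker p u 1 2 * v $ 4
     else - pluecker p u 2 3 * v $ 1 + pluecker p u 1 3 * v $ 2 - pluecker p u 1 2 * v $ 3)"

lemma cross4_nth:
  "cross4 p u v $ 1 = pluecker p u 3 4 * v $ 2 - pluecker p u 2 4 * v $ 3 + pluecker p u 2 3 * v $ 4"
  "cross4 p u v $ 2 = - pluecker p u 3 4 * v $ 1 + pluecker p u 1 4 * v $ 3 - pluecker p u 1 3 * v $ 4"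
  "cross4 p u v $ 3 = pluecker p u 2 4 * v $ 1 - pluecker p u 1 4 * v $ 2 + pluecker p u 1 2 * v $ 4"
  "cross4 p u v $ 4 = - pluecker p u 2 3 * v $ 1 + pluecker p u 1 3 * v $ 2 - pluecker p u 1 2 * v $ 3"
  unfolding cross4_def by simp_all

lemma cross4_linear:
  "cross4 p u (v + w) = cross4 p u v + cross4 p u w" "cross4 p u (c *s v) = c *s cross4 p u v"
  "cross4 p (c *s u) v = c *s cross4 p u v"
  by (rule vec4_eqI; simp add: cross4_nth pluecker_def algebra_simps)+

lemma cross4_last_equal [simp]: "cross4 p v v = 0"
  by (rule vec4_eqI) (simp_all add: cross4_nth pluecker_def algebra_simps)

lemma cross4_first_equal [simp]: "cross4 p p v = 0"
  by (rule vec4_eqI) (simp_all add: cross4_nth pluecker_def algebra_simps)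

lemma cross4_zero [simp]: "cross4 p u 0 = 0"
  by (rule vec4_eqI) (simp_all add: cross4_nth)

lemma bdot_cross4: "bdot v (cross4 p u v) = 0" "bdot p (cross4 p u v) = 0"
  by (simp_all add: cross4_nth pluecker_def bdot_def sum_4 algebra_simps)

lemma cross4_sum: "(\<Sum>k\<in>UNIV. u $ k *s cross4 p (axis k 1) v) = cross4 p u v"
  by (rule vec4_eqI) (simp_all add: cross4_nth pluecker_def sum_4 axis_def algebra_simps)

lemma cross4_eq_0:
  assumes "\<And>k v. cross4 p (axis k 1) v = 0"
  shows "p = 0"
proof -
  have "cross4 p (axis 4 1) (axis 3 1) = 0" "cross4 p (axis 4 1) (axis 2 1) = 0"
    "cross4 p (axis 3 1) (axis 2 1) = 0" using assms by blast+
  then have "cross4 p (axis 4 1) (axis 3 1) $ 1 = 0" "cross4 p (axis 4 1) (axis 3 1) $ 2 = 0"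
    "cross4 p (axis 4 1) (axis 2 1) $ 1 = 0" "cross4 p (axis 3 1) (axis 2 1) $ 1 = 0" by simp_all
  then show ?thesis by (intro vec4_eqI) (simp_all add: cross4_nth pluecker_def axis_def)
qed


section \<open>Net logarithmic sections on a smooth quadric\<close>

text \<open>The vector \<open>A' *v g\<close>, where \<open>g\<close> is the coefficient vector of a linear form, is the pole of the
  hyperplane: the point whose polar hyperplane with respect to the quadric is the given one.\<close>

locale quadric_matrix =
  fixes F :: poly4 and A A' :: "complex^4^4"
  assumes quadratic: "homogeneous 2 F"
    and symmetric: "transpose A = A"
    and F_value: "peval F v = bdot (A *v v) v"
    and F_gradient: "peval (partial i F) v = 2 * (A *v v) $ i"
    and inverse: "A *v (A' *v v) = v" "A' *v (A *v v) = v"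
begin

definition polar :: "complex^4 \<Rightarrow> complex^4 \<Rightarrow> complex" where
  "polar v w = bdot (A *v v) w"

sublocale nondegenerate_form polar
proof
  fix u v w c
  show "polar (u + v) w = polar u w + polar v w"
    by (simp add: polar_def matrix_vector_right_distrib bdot_simps)
  show "polar (c *s v) w = c * polar v w"
    by (simp add: polar_def bdot_simps vector_scalar_commute)
  show "polar v w = polar w v"
    unfolding polar_def by (rule bdot_symmetric_matrix[OF symmetric])
  assume "\<And>w. polar v w = 0"
  then have "A *v v = 0" unfolding polar_def by (rule bdot_nondegenerate)
  then show "v = 0" using inverse(2)[of v] by simp
qed

abbreviation Q :: "point set" where "Q \<equiv> vanishing F"

lemma cone_Q: "v \<in> cone Q \<longleftrightarrow> v \<noteq> 0 \<and> polar v v = 0"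
  by (simp add: cone_vanishing[OF quadratic] F_value polar_def)

lemma bdot_inverse: "bdot v (A' *v w) = bdot (A' *v v) w"
  using bdot_symmetric_matrix[OF symmetric, of "A' *v v" "A' *v w"]
  by (simp add: inverse bdot_commute)

text \<open>The global sections of \<open>O(1)\<close> on the quadric are the linear forms.\<close>

lemma twist1_linear:
  assumes s: "s \<in> twist Q 1 Q"
  shows "\<exists>m. \<forall>v. polar v v = 0 \<longrightarrow> s v = polar v m"
proof (rule linear_of_linear_on_isotropic_planes[of s])
  fix u w a b assume "polar u u = 0" "polar w w = 0" "polar u w = 0"
  then show "s (a *s u + b *s w) = a * s u + b * s w"
    using sym[of w u] by (intro twist1_linear_on_plane[OF s]) (simp add: cone_Q B_bilinear)
qed

lemma log_tangent_jacobian: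
  assumes t: "t \<in> log_tangent F G W" and G: "\<And>i v. peval (partial i G) v = g $ i"
  shows "polar v (t v) = 0" "bdot g (t v) = 0"
proof -
  have "jacobian_map F G t v = (0, 0)" using t by (simp add: log_tangent_def)
  then have "(\<Sum>i\<in>UNIV. 2 * (A *v v) $ i * t v $ i) = 0" "(\<Sum>i\<in>UNIV. g $ i * t v $ i) = 0"
    by (simp_all add: jacobian_map_def F_gradient G)
  then show "polar v (t v) = 0" "bdot g (t v) = 0"
    by (simp_all add: polar_def bdot_def mult.assoc flip: sum_distrib_left)
qed

lemma polar_pole: "polar (A' *v g) v = bdot g v"
  by (simp add: polar_def inverse)

text \<open>At the pole \<open>p\<close> the two rows of the Jacobian are proportional, so the equations at \<open>p\<close> itself give
  only one condition on \<open>t p\<close>. On the line \<open>p + z d\<close> they combine to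
  \<open>z * polar d (t (p + z d)) = 0\<close>; dividing by \<open>z\<close> and letting \<open>z\<close> tend to 0 gives one condition
  for every direction \<open>d\<close>.\<close>

lemma log_tangent_pole:
  assumes t: "t \<in> log_tangent F G W" and G: "\<And>i v. peval (partial i G) v = g $ i"
    and W: "zariski_open W" and p: "A' *v g \<in> cone W"
  shows "t (A' *v g) = 0"
proof -
  let ?p = "A' *v g"
  have "polar d (t ?p) = 0" for d
  proof -
    define h where "h z = polar d (t (?p + z *s d))" for z
    have "h z = 0" if "z \<noteq> 0" for z
    proof -
      have "polar (?p + z *s d) (t (?p + z *s d)) = 0" "bdot g (t (?p + z *s d)) = 0"
        using log_tangent_jacobian[OF t G] by blast+
      then show ?thesis using that by (simp add: h_def B_bilinear polar_pole)
    qed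
    then have "(h \<longlongrightarrow> 0) (at 0)"
      by (intro tendsto_eventually) (simp add: eventually_at_filter)
    moreover have "(h \<longlongrightarrow> h 0) (at 0)"
    proof -
      have sub: "cone W \<subseteq> cone proj3"
        using W by (auto simp: zariski_open_def cone_iff)
      have cont: "isCont (\<lambda>z. t (?p + z *s d) $ i) 0" for i
      proof -
        have "(\<lambda>v. t v $ i) \<in> twist proj3 1 W"
          using t by (simp add: log_tangent_def twist1_pow4_def)
        then have "(\<lambda>z. t (?p + z *s d) $ i) field_differentiable at 0"
          by (rule twist_line_differentiable[OF _ _ open_line_in_cone[OF W, of ?p d]])
            (use p sub in auto)
        then show ?thesis by (rule field_differentiable_imp_continuous_at)
      qed
      then have "isCont h 0"
        unfolding h_def polar_def bdot_def by (intro continuous_sum continuous_mult continuous_const cont)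
      then show ?thesis by (simp add: isCont_def)
    qed
    ultimately have "h 0 = 0" using tendsto_unique[OF at_neq_bot] by blast
    then show ?thesis by (simp add: h_def)
  qed
  then have "bdot w (t ?p) = 0" for w
    using polar_pole[of w "t ?p"] by metis
  then show ?thesis by (intro bdot_nondegenerate) (simp add: bdot_commute)
qed

lemma net_log_sections_local:
  assumes s: "s \<in> net_log_sections F G Q" and v: "v \<in> cone Q"
  obtains W n a t where "zariski_open W" "v \<in> cone W"
    "\<And>j. j < (n::nat) \<Longrightarrow> t j \<in> log_tangent F G W"
    "s v = (\<Sum>j<n. a j *s t j v)"
proof -
  have "vec.span {v} \<in> Q" using v by (simp add: cone_iff)
  then obtain W n a t where W: "openin zariski W" "vec.span {v} \<in> W"
    and t: "\<forall>j<(n::nat). a j \<in> twist Q 0 (W \<inter> Q) \<and> t j \<in> log_tangent F G W"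
    and eq: "\<forall>v\<in>cone (W \<inter> Q). s v = (\<Sum>j<n. a j v *s t j v)"
    using s unfolding net_log_sections_def by blast
  have W': "v \<in> cone W" using W(2) v by (simp add: cone_iff)
  then have "s v = (\<Sum>j<n. a j v *s t j v)" using eq v by (simp add: cone_Int)
  then show ?thesis
    by (intro that[of W n t "\<lambda>j. a j v"]) (use W W' t in \<open>simp_all add: openin_zariski\<close>)
qed

lemma net_log_sections_tangent:
  assumes s: "s \<in> net_log_sections F G Q" and G: "\<And>i v. peval (partial i G) v = g $ i"
    and v: "v \<in> cone Q"
  shows "polar v (s v) = 0" "bdot g (s v) = 0"
proof -
  obtain W n a t where "zariski_open W" "v \<in> cone W"
    and t: "\<And>j. j < (n::nat) \<Longrightarrow> t j \<in> log_tangent F G W"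
    and sv: "s v = (\<Sum>j<n. a j *s t j v)"
    using s v by (rule net_log_sections_local) blast
  have sum: "bdot x (\<Sum>j<n. a j *s t j v) = (\<Sum>j<n. a j * bdot x (t j v))" for x
    by (induction n) (simp_all add: bdot_simps)
  show "polar v (s v) = 0"
    unfolding sv polar_def sum using log_tangent_jacobian(1)[OF t G] by (simp add: polar_def)
  show "bdot g (s v) = 0"
    unfolding sv sum using log_tangent_jacobian(2)[OF t G] by simp
qed

text \<open>For a tangent hyperplane, this is where the image sheaf differs from the kernel of the Jacobian on
  the quadric: the kernel has further sections, which do not vanish at the pole.\<close>

lemma net_log_sections_pole:
  assumes s: "s \<in> net_log_sections F G Q" and G: "\<And>i v. peval (partial i G) v = g $ i"
    and p: "A' *v g \<in> cone Q"
  shows "s (A' *v g) = 0"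
proof -
  obtain W n a t where W: "zariski_open W" "A' *v g \<in> cone W"
    and t: "\<And>j. j < (n::nat) \<Longrightarrow> t j \<in> log_tangent F G W"
    and sp: "s (A' *v g) = (\<Sum>j<n. a j *s t j (A' *v g))"
    using s p by (rule net_log_sections_local) blast
  show ?thesis unfolding sp using log_tangent_pole[OF t G W] by simp
qed

text \<open>The logarithmic vector fields \<open>koszul g U k\<close> are the Koszul syzygies of the linear forms that
  vanish at the pole, and they depend on one vector of the four-space modulo the pole. Four of them,
  indexed by the standard basis, are used instead of three, because then their relations have a
  simple form: the combination with coefficients \<open>p $ k\<close>, for the pole \<open>p\<close>, and the one with
  coefficients \<open>v $ k\<close> at each point \<open>v\<close> are 0.\<close>

definition koszul :: "complex^4 \<Rightarrow> point set \<Rightarrow> 4 \<Rightarrow> complex^4 \<Rightarrow> complex^4" where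
  "koszul g U k v = (if v \<in> cone U then A' *v cross4 (A' *v g) (axis k 1) v else 0)"

lemma koszul_in_twist:
  assumes "openin (subtopology zariski X) U"
  shows "(\<lambda>v. koszul g U k v $ i) \<in> twist X 1 U"
proof -
  have "(\<lambda>v. if v \<in> cone U then (A' *v cross4 (A' *v g) (axis k 1) v) $ i else 0) \<in> twist X 1 U"
    by (rule linear_in_twist[OF assms])
      (simp_all add: cross4_linear matrix_vector_right_distrib vector_scalar_commute)
  then show ?thesis by (simp add: koszul_def if_distrib[of "\<lambda>x. x $ i"] cong: if_cong)
qed

lemma koszul_log_tangent:
  assumes W: "zariski_open W" and G: "\<And>i v. peval (partial i G) v = g $ i"
  shows "koszul g W k \<in> log_tangent F G W"
proof -
  have sub: "openin (subtopology zariski proj3) W"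
    using W by (simp add: openin_zariski flip: topspace_zariski)
  have "jacobian_map F G (koszul g W k) v = (2 * bdot (A *v v) (koszul g W k v), bdot g (koszul g W k v))" for v
    by (simp add: jacobian_map_def F_gradient G bdot_def sum_distrib_left mult.assoc)
  also have "\<dots> v = (0, 0)" for v
    by (simp add: koszul_def bdot_inverse inverse bdot_cross4 bdot_simps)
  finally show ?thesis
    using koszul_in_twist[OF sub] by (simp add: log_tangent_def twist1_pow4_def fun_eq_iff)
qed

text \<open>The number of tensors in the definition of a section is a natural number, which is why the four
  coordinates are enumerated by \<open>h\<close>.\<close>

lemma koszul_combination:
  assumes U: "openin (subtopology zariski Q) U" and a: "\<And>k. a k \<in> twist Q 0 U"
    and G: "\<And>i v. peval (partial i G) v = g $ i"
  shows "(\<lambda>v. \<Sum>k\<in>UNIV. a k v *s koszul g U k v) \<in> net_log_sections F G U"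
proof -
  obtain W where W: "zariski_open W" and UW: "U = W \<inter> Q"
    using U by (auto simp: openin_subtopology openin_zariski)
  obtain h :: "nat \<Rightarrow> 4" where h: "bij_betw h {..<4} UNIV"
    using ex_bij_betw_nat_finite[of "UNIV :: 4 set"] by (auto simp: atLeast0LessThan)
  have "(\<lambda>v. \<Sum>k\<in>UNIV. a k v * koszul g U k v $ i) \<in> twist Q 1 U" for i
    using twist_mult[OF a koszul_in_twist[OF U]] by (intro twist_sum[OF U]) simp_all
  then have tw: "(\<lambda>v. \<Sum>k\<in>UNIV. a k v *s koszul g U k v) \<in> twist1_pow4 Q U"
    by (simp add: twist1_pow4_def)
  have eq: "(\<Sum>k\<in>UNIV. a k v *s koszul g U k v) = (\<Sum>j<4. a (h j) v *s koszul g W (h j) v)"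
    if "v \<in> cone (W \<inter> Q)" for v
  proof -
    have "(\<Sum>k\<in>UNIV. a k v *s koszul g U k v) = (\<Sum>k\<in>UNIV. a k v *s koszul g W k v)"
      using that unfolding UW by (simp add: koszul_def cone_Int)
    then show ?thesis using sum.reindex_bij_betw[OF h, of "\<lambda>k. a k v *s koszul g W k v"] by simp
  qed
  have "\<exists>W. openin zariski W \<and> p \<in> W \<and> W \<inter> Q \<subseteq> U \<and>
       (\<exists>(n::nat) a' t. (\<forall>j<n. a' j \<in> twist Q 0 (W \<inter> Q) \<and> t j \<in> log_tangent F G W) \<and>
          (\<forall>v\<in>cone (W \<inter> Q). (\<Sum>k\<in>UNIV. a k v *s koszul g U k v) = (\<Sum>j<n. a' j v *s t j v)))"
    if "p \<in> U" for p
  proof (rule exI[of _ W], intro conjI)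
    show "\<exists>(n::nat) a' t. (\<forall>j<n. a' j \<in> twist Q 0 (W \<inter> Q) \<and> t j \<in> log_tangent F G W) \<and>
          (\<forall>v\<in>cone (W \<inter> Q). (\<Sum>k\<in>UNIV. a k v *s koszul g U k v) = (\<Sum>j<n. a' j v *s t j v))"
      by (rule exI[of _ 4], rule exI[of _ "\<lambda>j. a (h j)"], rule exI[of _ "\<lambda>j. koszul g W (h j)"])
        (use a eq koszul_log_tangent[OF W G] in \<open>simp add: UW\<close>)
  qed (use that W in \<open>simp_all add: UW openin_zariski\<close>)
  then show ?thesis using tw by (simp add: net_log_sections_def)
qed

section \<open>Recovering the pole from the sheaf\<close>

lemma koszul_partial_combination:
  assumes U: "openin (subtopology zariski Q) U" and a: "\<And>k. k \<in> S \<Longrightarrow> a k \<in> twist Q 0 U"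
    and G: "\<And>i v. peval (partial i G) v = g $ i"
  shows "(\<lambda>v. \<Sum>k\<in>S. a k v *s koszul g U k v) \<in> net_log_sections F G U"
proof -
  define b where "b k = (if k \<in> S then a k else (\<lambda>v. 0))" for k
  have "b k \<in> twist Q 0 U" for k
    using a zero_in_twist[OF U] by (simp add: b_def)
  then have "(\<lambda>v. \<Sum>k\<in>UNIV. b k v *s koszul g U k v) \<in> net_log_sections F G U"
    by (rule koszul_combination[OF U _ G])
  moreover have "(\<Sum>k\<in>UNIV. b k v *s koszul g U k v) = (\<Sum>k\<in>S. a k v *s koszul g U k v)" for v
    by (rule sum.mono_neutral_cong_right) (auto simp: b_def)
  ultimately show ?thesis by simp
qed

lemma koszul_in_net_log_sections:
  assumes U: "openin (subtopology zariski Q) U" and G: "\<And>i v. peval (partial i G) v = g $ i"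
  shows "koszul g U k \<in> net_log_sections F G U"
proof -
  have "(\<lambda>v. \<Sum>k\<in>{k}. (if v \<in> cone U then 1 else 0) *s koszul g U k v) \<in> net_log_sections F G U"
    by (rule koszul_partial_combination[OF U constant_in_twist[OF U] G])
  moreover have "(\<lambda>v. \<Sum>k\<in>{k}. (if v \<in> cone U then 1 else 0) *s koszul g U k v) = koszul g U k"
    by (simp add: koszul_def fun_eq_iff)
  ultimately show ?thesis by (simp only:)
qed

lemma module_hom_koszul:
  assumes U: "openin (subtopology zariski Q) U" and G: "\<And>i v. peval (partial i G) v = g $ i"
    and f: "f \<in> module_iso (structure_sheaf Q U) (sections (net_log_tangent_sheaf F G) U)
              (sections (net_log_tangent_sheaf F G') U)"
    and a: "\<And>k. a k \<in> twist Q 0 U"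
  shows "f (\<lambda>v. \<Sum>k\<in>S. a k v *s koszul g U k v) = (\<lambda>v. \<Sum>k\<in>S. a k v *s f (koszul g U k) v)"
proof -
  have add: "f (\<lambda>v. s v + t v) = (\<lambda>v. f s v + f t v)"
    if "s \<in> net_log_sections F G U" "t \<in> net_log_sections F G U" for s t
    using f that by (simp add: module_iso_def net_log_tangent_sheaf_def)
  have scale: "f (\<lambda>v. c v *s s v) = (\<lambda>v. c v *s f s v)"
    if "c \<in> twist Q 0 U" "s \<in> net_log_sections F G U" for c s
    using f that by (simp add: module_iso_def net_log_tangent_sheaf_def structure_sheaf_def)
  have mem: "(\<lambda>v. \<Sum>k\<in>S. a k v *s koszul g U k v) \<in> net_log_sections F G U" for S
    by (rule koszul_partial_combination[OF U _ G]) (rule a)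
  have "finite S" by simp
  then show ?thesis
  proof (induction S rule: finite_induct)
    case empty
    have "(\<lambda>v. 0) \<in> net_log_sections F G U" using mem[of "{}"] by simp
    from add[OF this this] show ?case by (simp add: fun_eq_iff)
  next
    case (insert k S)
    have k: "(\<lambda>v. a k v *s koszul g U k v) \<in> net_log_sections F G U" using mem[of "{k}"] by simp
    have "f (\<lambda>v. \<Sum>k\<in>insert k S. a k v *s koszul g U k v)
        = f (\<lambda>v. a k v *s koszul g U k v + (\<Sum>k\<in>S. a k v *s koszul g U k v))"
      using insert.hyps by simp
    also have "\<dots> = (\<lambda>v. f (\<lambda>v. a k v *s koszul g U k v) v + f (\<lambda>v. \<Sum>k\<in>S. a k v *s koszul g U k v) v)"
      by (rule add[OF k mem])
    also have "f (\<lambda>v. a k v *s koszul g U k v) = (\<lambda>v. a k v *s f (koszul g U k) v)"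
      by (rule scale[OF a koszul_in_net_log_sections[OF U G]])
    finally show ?case unfolding insert.IH using insert.hyps by simp
  qed
qed

lemma polar_sum_right: "polar w (\<Sum>k\<in>K. x k) = (\<Sum>k\<in>K. polar w (x k))"
  by (induction K rule: infinite_finite_induct) (simp_all add: B_bilinear)

lemma koszul_sum:
  "(\<Sum>k\<in>UNIV. u $ k *s koszul g U k v) = (if v \<in> cone U then A' *v cross4 (A' *v g) u v else 0)"
proof (cases "v \<in> cone U")
  case True
  have lin: "A' *v (\<Sum>k\<in>K. x k) = (\<Sum>k\<in>K. A' *v x k)" for x :: "4 \<Rightarrow> complex^4" and K
    by (induction K rule: infinite_finite_induct) (simp_all add: matrix_vector_right_distrib)
  have "(\<Sum>k\<in>UNIV. u $ k *s koszul g U k v) = A' *v (\<Sum>k\<in>UNIV. u $ k *s cross4 (A' *v g) (axis k 1) v)"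
    using True by (simp add: koszul_def lin vector_scalar_commute)
  then show ?thesis using True by (simp add: cross4_sum)
qed (simp add: koszul_def)

lemma openin_Q: "openin (subtopology zariski Q) Q"
proof -
  have "topspace (subtopology zariski Q) = Q"
    by (auto simp: topspace_zariski vanishing_def)
  then show ?thesis by (metis openin_topspace)
qed

text \<open>The relation with coefficients \<open>v $ k\<close> has coefficients of degree 1. Dividing by the coordinate
  \<open>v $ i\<close> makes it a relation over the structure sheaf where that coordinate does not vanish.\<close>

lemma coordinate_chart:
  obtains U where "openin (subtopology zariski Q) U" "U \<subseteq> Q"
    "\<And>v. v \<in> cone U \<longleftrightarrow> v \<in> cone Q \<and> v $ i \<noteq> 0"
    "\<And>k. (\<lambda>v. if v \<in> cone U then v $ k / v $ i else 0) \<in> twist Q 0 U"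
proof -
  obtain X where X: "\<And>k. homogeneous 1 (X k)" "\<And>k v. peval (X k) v = v $ k"
  proof -
    have "\<exists>f. homogeneous 1 f \<and> (\<forall>v. peval f v = v $ k)" for k
      using linear_form_poly[of "axis k 1"] by (metis bdot_axis bdot_commute)
    then show ?thesis using that by metis
  qed
  define U where "U = (proj3 - vanishing (X i)) \<inter> Q"
  have "zariski_open (proj3 - vanishing (X i))"
    unfolding zariski_open_def by (rule exI[of _ "{X i}"]) (use X(1) in auto)
  then have U: "openin (subtopology zariski Q) U"
    unfolding U_def openin_subtopology openin_zariski by blast
  have cone: "v \<in> cone U \<longleftrightarrow> v \<in> cone Q \<and> v $ i \<noteq> 0" for v
  proof (cases "v = 0")
    case False
    then have "vec.span {v} \<in> proj3" by (auto simp: proj3_def)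
    then show ?thesis using span_in_vanishing_iff[OF X(1)[of i] False] by (auto simp: U_def cone_iff X(2))
  qed (simp add: cone_iff)
  have "(\<lambda>v. if v \<in> cone U then v $ k / v $ i else 0) \<in> twist Q 0 U" for k
    by (rule twistI[OF U, where a = "X k" and b = "X i" and e = 1]) (use X cone in simp_all)
  then show ?thesis using that[OF U _ cone] by (simp add: U_def)
qed

text \<open>The images \<open>s k\<close> of the Koszul sections are linear on the isotropic cone, say equal to \<open>L k\<close>. They
  combine to a trilinear form \<open>\<tau>\<close> which satisfies the hypotheses of \<open>trilinear_vanishes\<close>: the
  conditions on the last two arguments say that each \<open>s k\<close> is a section of the second sheaf, and those
  on the first argument are the relations between the Koszul sections, which every isomorphism
  preserves. Vanishing of \<open>\<tau>\<close> contradicts injectivity on global sections.\<close>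

lemma no_isomorphism_if_poles_independent:
  assumes iso: "module_sheaf_iso (subtopology zariski Q) (structure_sheaf Q)
      (net_log_tangent_sheaf F G) (net_log_tangent_sheaf F G')"
    and G: "\<And>i v. peval (partial i G) v = g $ i" and G': "\<And>i v. peval (partial i G') v = g' $ i"
    and indep: "\<And>a b. a *s (A' *v g) + b *s (A' *v g') = 0 \<Longrightarrow> a = 0 \<and> b = 0"
  shows False
proof -
  obtain \<phi> where \<phi>: "\<forall>U. openin (subtopology zariski Q) U \<longrightarrow>
        \<phi> U \<in> module_iso (structure_sheaf Q U) (sections (net_log_tangent_sheaf F G) U)
          (sections (net_log_tangent_sheaf F G') U)"
    and natural: "\<forall>U W. openin (subtopology zariski Q) U \<and> openin (subtopology zariski Q) W \<and> W \<subseteq> U \<longrightarrow>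
        (\<forall>s\<in>carrier (sections (net_log_tangent_sheaf F G) U).
          \<phi> W (restr (net_log_tangent_sheaf F G) U W s) = restr (net_log_tangent_sheaf F G') U W (\<phi> U s))"
    using iso unfolding module_sheaf_iso_def by (elim exE conjE) (rule that)
  note \<phi> = \<phi>[rule_format]
  define s where "s k = \<phi> Q (koszul g Q k)" for k
  have mem: "koszul g U k \<in> net_log_sections F G U" if "openin (subtopology zariski Q) U" for U k
    using koszul_in_net_log_sections[OF that G] .
  have bij: "bij_betw (\<phi> Q) (net_log_sections F G Q) (net_log_sections F G' Q)"
    using \<phi>[OF openin_Q] by (simp add: module_iso_def net_log_tangent_sheaf_def)
  have s: "s k \<in> net_log_sections F G' Q" for k
    using bij_betwE[OF bij] mem[OF openin_Q] by (simp add: s_def)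
  have zero: "\<phi> U (\<lambda>v. 0) = (\<lambda>v. 0)" if "openin (subtopology zariski Q) U" for U
    using module_hom_koszul[where S = "{}" and a = "\<lambda>_ _. 0", OF that G \<phi>[OF that] zero_in_twist[OF that]]
    by simp
  \<comment> \<open>Relations between the Koszul sections over any open set are inherited by their images.\<close>
  have relation: "(\<Sum>k\<in>UNIV. a k v *s s k v) = 0"
    if U: "openin (subtopology zariski Q) U" "U \<subseteq> Q" and a: "\<And>k. a k \<in> twist Q 0 U"
      and rel: "\<And>v. v \<in> cone U \<Longrightarrow> (\<Sum>k\<in>UNIV. a k v *s koszul g U k v) = 0" and v: "v \<in> cone U" for U a v
  proof -
    have "koszul g U k = restr (net_log_tangent_sheaf F G) Q U (koszul g Q k)" for k
      using U(2) by (auto simp: net_log_tangent_sheaf_def koszul_def fun_eq_iff cone_iff)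
    then have res: "\<phi> U (koszul g U k) = restr (net_log_tangent_sheaf F G') Q U (s k)" for k
      using natural openin_Q U mem[OF openin_Q] by (simp add: s_def net_log_tangent_sheaf_def)
    have "(\<lambda>v. \<Sum>k\<in>UNIV. a k v *s koszul g U k v) = (\<lambda>v. 0)"
    proof
      fix v
      show "(\<Sum>k\<in>UNIV. a k v *s koszul g U k v) = 0"
      proof (cases "v \<in> cone U")
        case False
        then show ?thesis by (simp add: koszul_def)
      qed (rule rel)
    qed
    then have "(\<lambda>v. \<Sum>k\<in>UNIV. a k v *s \<phi> U (koszul g U k) v) = (\<lambda>v. 0)"
      using module_hom_koszul[where f = "\<phi> U" and S = UNIV and a = a, OF U(1) G \<phi>[OF U(1)] a] zero[OF U(1)] by simp
    from fun_cong[OF this, of v] show ?thesis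
      using v by (simp add: res net_log_tangent_sheaf_def)
  qed
  have "\<exists>m. \<forall>v. polar v v = 0 \<longrightarrow> s k v $ i = polar v m" for k i
  proof -
    have "(\<lambda>v. s k v $ i) \<in> twist Q 1 Q" using s by (simp add: net_log_sections_def twist1_pow4_def)
    then show ?thesis by (rule twist1_linear)
  qed
  then obtain m where m: "\<And>k i v. polar v v = 0 \<Longrightarrow> s k v $ i = polar v (m k i)" by metis
  define L where "L k v = (\<chi> i. polar v (m k i))" for k v
  have Ls: "L k v = s k v" if "polar v v = 0" for k v
    using m that by (simp add: L_def vec_eq_iff)
  have L_linear: "L k (u + v) = L k u + L k v" "L k (c *s v) = c *s L k v" for k u v c
    by (simp_all add: L_def B_bilinear vec_eq_iff)
  have L0: "L k 0 = 0" for k by (simp add: L_def vec_eq_iff)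
  define \<tau> where "\<tau> u v w = (\<Sum>k\<in>UNIV. u $ k * polar w (L k v))" for u v w
  have \<tau>_polar: "\<tau> u v w = polar w (\<Sum>k\<in>UNIV. u $ k *s L k v)" for u v w
    by (simp add: \<tau>_def polar_sum_right B_bilinear)
  have \<tau>_zero: "\<tau> u v w = 0" for u v w
  proof (rule trilinear_vanishes[where p = "A' *v g" and p' = "A' *v g'"])
    fix u v w
    show "bilinear_form (\<lambda>u v. \<tau> u v w)" "bilinear_form (\<tau> u)"
      by (simp_all add: bilinear_form_def \<tau>_def L_linear B_bilinear algebra_simps sum.distrib sum_distrib_left)
    show "\<tau> u v v = 0" if "polar v v = 0"
    proof (cases "v = 0")
      case False
      then show ?thesis using net_log_sections_tangent(1)[OF s G', of v] that by (simp add: \<tau>_def Ls cone_Q)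
    qed (simp add: \<tau>_def)
    have "bdot g' (L k v) = 0" for k v
    proof (rule linear_vanishing_on_isotropic[where f = "\<lambda>v. bdot g' (L k v)"])
      show "bdot g' (L k v) = 0" if "polar v v = 0" for v
      proof (cases "v = 0")
        case False
        then show ?thesis using net_log_sections_tangent(2)[OF s G', of v] that by (simp add: Ls cone_Q)
      qed (simp add: L0 bdot_simps)
    qed (simp_all add: L_linear bdot_simps)
    then show "\<tau> u v (A' *v g') = 0" by (simp add: \<tau>_def polar_pole)
    show "\<tau> u (A' *v g') w = 0" if "polar (A' *v g') (A' *v g') = 0"
    proof -
      have "A' *v g' \<noteq> 0" using indep[of 0 1] by auto
      then have "s k (A' *v g') = 0" for k
        using that by (intro net_log_sections_pole[OF s G']) (simp add: cone_Q)
      then show ?thesis using that by (simp add: \<tau>_def Ls)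
    qed
    show "\<tau> v v w = 0" if "polar v v = 0"
    proof (cases "v = 0")
      case False
      then obtain i where i: "v $ i \<noteq> 0" by (auto simp: vec_eq_iff)
      obtain U where U: "openin (subtopology zariski Q) U" "U \<subseteq> Q"
        and cone: "\<And>v. v \<in> cone U \<longleftrightarrow> v \<in> cone Q \<and> v $ i \<noteq> 0"
        and a: "\<And>k. (\<lambda>v. if v \<in> cone U then v $ k / v $ i else 0) \<in> twist Q 0 U"
        by (rule coordinate_chart[of i]) blast
      have v: "v \<in> cone U" using False that i by (simp add: cone cone_Q)
      have "(\<Sum>k\<in>UNIV. (if x \<in> cone U then x $ k / x $ i else 0) *s koszul g U k x) = 0"
        if x: "x \<in> cone U" for x
      proof -
        have "(\<Sum>k\<in>UNIV. (if x \<in> cone U then x $ k / x $ i else 0) *s koszul g U k x)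
            = (\<Sum>k\<in>UNIV. ((1 / x $ i) *s x) $ k *s koszul g U k x)"
          using x by simp
        then show ?thesis by (simp only: koszul_sum) (simp add: cross4_linear)
      qed
      from relation[OF U a this v] have "(\<Sum>k\<in>UNIV. (v $ k / v $ i) *s s k v) = 0" using v by simp
      then have "v $ i *s (\<Sum>k\<in>UNIV. (v $ k / v $ i) *s s k v) = 0" by simp
      then have "(\<Sum>k\<in>UNIV. v $ k *s s k v) = 0" using i by (simp add: vec.scale_sum_right)
      then show ?thesis using that by (simp add: \<tau>_polar Ls)
    qed (simp add: \<tau>_def)
    show "\<tau> (A' *v g) v w = 0"
    proof (rule linear_vanishing_on_isotropic[where f = "\<lambda>v. \<tau> (A' *v g) v w"])
      show "\<tau> (A' *v g) v w = 0" if "polar v v = 0" for v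
      proof (cases "v = 0")
        case False
        have v: "v \<in> cone Q" using False that by (simp add: cone_Q)
        have "(\<Sum>k\<in>UNIV. (if v \<in> cone Q then (A' *v g) $ k else 0) *s s k v) = 0"
        proof (rule relation[OF openin_Q order_refl constant_in_twist[OF openin_Q] _ v])
          fix x assume "x \<in> cone Q"
          then have "(\<Sum>k\<in>UNIV. (if x \<in> cone Q then (A' *v g) $ k else 0) *s koszul g Q k x)
              = (\<Sum>k\<in>UNIV. (A' *v g) $ k *s koszul g Q k x)" by simp
          then show "(\<Sum>k\<in>UNIV. (if x \<in> cone Q then (A' *v g) $ k else 0) *s koszul g Q k x) = 0"
            by (simp only: koszul_sum cross4_first_equal) simp
        qed
        then show ?thesis using v that by (simp add: \<tau>_polar Ls)
      qed (simp add: \<tau>_def L0)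
    qed (simp_all add: \<tau>_def L_linear B_bilinear algebra_simps sum.distrib sum_distrib_left)
  qed (rule indep)
  have "s k v = 0" for k v
  proof (cases "v \<in> cone Q")
    case True
    have "L k v = 0"
    proof (rule nondegenerate)
      fix w
      have "\<tau> (axis k 1) v w = polar w (L k v)"
        by (simp add: \<tau>_def axis_def if_distrib if_distribR cong: if_cong)
      then show "polar (L k v) w = 0" using \<tau>_zero sym by simp
    qed
    then show ?thesis using Ls True by (simp add: cone_Q)
  next
    case False
    then have "s k v $ i = 0" for i
      using s by (auto simp: net_log_sections_def twist1_pow4_def twist_def)
    then show ?thesis by (simp add: vec_eq_iff)
  qed
  then have "\<phi> Q (koszul g Q k) = \<phi> Q (\<lambda>v. 0)" for k
    using zero[OF openin_Q] by (simp add: s_def fun_eq_iff)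
  moreover have "(\<lambda>v. 0) \<in> net_log_sections F G Q"
    using koszul_partial_combination[OF openin_Q _ G, of "{}"] by simp
  ultimately have "koszul g Q k = (\<lambda>v. 0)" for k
    using inj_onD[OF bij_betw_imp_inj_on[OF bij]] mem[OF openin_Q] by blast
  then have koszul0: "koszul g Q k v = 0" for k v by (rule fun_cong)
  have iso0: "cross4 (A' *v g) (axis k 1) v = 0" if "v \<in> cone Q" for k v
  proof -
    have "A' *v cross4 (A' *v g) (axis k 1) v = 0"
      using koszul0[of k v] that by (simp only: koszul_def if_True)
    then have "A *v (A' *v cross4 (A' *v g) (axis k 1) v) = 0" by simp
    then show ?thesis by (simp only: inverse)
  qed
  have "cross4 (A' *v g) (axis k 1) v $ i = 0" for k v i
  proof (rule linear_vanishing_on_isotropic[where f = "\<lambda>v. cross4 (A' *v g) (axis k 1) v $ i"])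
    show "cross4 (A' *v g) (axis k 1) v $ i = 0" if "polar v v = 0" for v
      using iso0[of v k] that by (cases "v = 0") (simp_all add: cone_Q)
  qed (simp_all add: cross4_linear)
  then have "cross4 (A' *v g) (axis k 1) v = 0" for k v
    by (intro vec4_eqI) (simp_all only: zero_index)
  then have "A' *v g = 0" by (rule cross4_eq_0)
  then show False using indep[of 1 0] by simp
qed

end

theorem mainTheorem4:
  fixes F G G' :: poly4
  assumes "smooth_quadric F"
    and "hyperplane_form G" and "hyperplane_form G'"
    and "vanishing G \<noteq> vanishing G'"
  shows "\<not> module_sheaf_iso (subtopology zariski (vanishing F)) (structure_sheaf (vanishing F))
           (net_log_tangent_sheaf F G) (net_log_tangent_sheaf F G')"
proof
  assume iso: "module_sheaf_iso (subtopology zariski (vanishing F)) (structure_sheaf (vanishing F))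
           (net_log_tangent_sheaf F G) (net_log_tangent_sheaf F G')"
  obtain A where A: "transpose A = A" "\<And>v. peval F v = bdot (A *v v) v"
    "\<And>i v. peval (partial i F) v = 2 * (A *v v) $ i" "invertible A"
    using assms(1) by (rule smooth_quadric_gram_matrix) blast
  obtain A' where A': "A ** A' = mat 1" "A' ** A = mat 1"
    using A(4) unfolding invertible_def by blast
  interpret quadric_matrix F A A'
    using assms(1) A A' by unfold_locales (simp_all add: smooth_quadric_def matrix_vector_mul_assoc)
  obtain g where g: "g \<noteq> 0" "\<And>v. peval G v = bdot g v" "\<And>i v. peval (partial i G) v = g $ i"
    using assms(2) by (rule hyperplane_vector) blast
  obtain g' where g': "g' \<noteq> 0" "\<And>v. peval G' v = bdot g' v" "\<And>i v. peval (partial i G') v = g' $ i"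
    using assms(3) by (rule hyperplane_vector) blast
  have "a = 0 \<and> b = 0" if eq: "a *s (A' *v g) + b *s (A' *v g') = 0" for a b
  proof (rule ccontr)
    assume ab: "\<not> (a = 0 \<and> b = 0)"
    have "A *v (a *s (A' *v g) + b *s (A' *v g')) = 0" by (simp add: eq)
    then have rel: "a *s g + b *s g' = 0"
      by (simp add: matrix_vector_right_distrib vector_scalar_commute inverse)
    then have "a \<noteq> 0" "b \<noteq> 0" using ab g(1) g'(1) by auto
    have "a * bdot g v + b * bdot g' v = 0" for v
      using arg_cong[OF rel, of "\<lambda>x. bdot x v"] by (simp add: bdot_simps)
    then have "bdot g v = 0 \<longleftrightarrow> bdot g' v = 0" for v
      using \<open>a \<noteq> 0\<close> \<open>b \<noteq> 0\<close> by (metis add.left_neutral add.right_neutral mult_eq_0_iff)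
    then have "vanishing G = vanishing G'"
      by (simp add: vanishing_def g(2) g'(2))
    then show False using assms(4) by simp
  qed
  then show False by (rule no_isomorphism_if_poles_independent[OF iso g(3) g'(3)])
qed

end
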